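(* Let $A=\langle\langle X\rangle\rangle$ be a PAJ generated by a set $X$ of primitive axes, and let $\{X_i: i\in I\}$ be the connected components of $\operatorname{Cl}(X)$ in the axial graph. Then $A$ is the sum of the subalgebras $A_i:=\langle\langle X_i\rangle\rangle$, $i\in I$, and each $A_i$ is uniformly generated.
   Context: Algebras are not necessarily associative, commutative or unital. $\mathbb F$ is a field of characteristic $\ne 2$ and $A$ is an $\mathbb F$-algebra. $\langle\langle X\rangle\rangle$ is the subalgebra of $A$ generated by $X$. For an idempotent $a\in A$ put $A_0(a)=\{y\in A: ay=ya=0\}$ and $A_{\lambda,\delta}(a)=\{y\in A: ay=\lambda y,\ ya=\delta y\}$. For $\lambda,\delta\in\mathbb F\setminus\{0,1\}$, a primitive axis of type $(\lambda,\delta)$ is a nonzero idempotent $a\in A$ with $\{y:ay=y\}=\mathbb Fa=\{y:ya=y\}$, such that $A=\mathbb Fa\oplus A_0(a)\oplus A_{\lambda,\delta}(a)$ and this is a $\mathbb Z_2$-grading with even part $\mathbb Fa\oplus A_0(a)$ and odd part $A_{\lambda,\delta}(a)$. If $\lambda=\delta$ the type is called commutative and is also denoted $\lambda$; if $\lambda\neq\delta$ it is called noncommutative, and then $\lambda+\delta=1$ (a known fact, taken as a convention). Each primitive axis is regarded as carrying exactly one type (if $A_{\lambda,\delta}(a)=0$, a fixed choice is made). A PAJ is an algebra generated by a set of primitive axes (possibly of different types). The Miyamoto involution of a primitive axis $a$ of type $(\lambda,\delta)$ is the automorphism $\tau_a$ of $A$ that is the identity on $\mathbb Fa\oplus A_0(a)$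 and $-1$ on $A_{\lambda,\delta}(a)$. $\mathcal G(X)$ is the group generated by $\{\tau_x:x\in X\}$ and $\operatorname{Cl}(X)=\{\rho(x): x\in X,\ \rho\in\mathcal G(X)\}$. The axial graph has as vertices all primitive axes of $A$, with $x',x''$ joined by an edge when $x'x''\neq0$ (equivalently $x''x'\ne0$); for a set of axes one takes the full induced subgraph. A PAJ is uniformly generated if it is generated by a set of primitive axes that is uniform, i.e. either all of its axes have the same commutative type $\lambda$, or there are $\lambda\ne\delta$ such that each of its axes has type $(\lambda,\delta)$ or $(\delta,\lambda)$. *)

theory Defs
  imports Complex_Main "HOL-Algebra.Bij" "HOL-Algebra.Generated_Groups"
begin

text \<open>
  The algebra \<open>A\<close> is a whole type \<open>'a\<close>. Notions relative to an algebra take a carrier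
  \<open>B :: 'a set\<close>, so that they apply both to \<open>A\<close> itself (\<open>B = UNIV\<close>) and to a
  subalgebra regarded as an algebra in its own right.
\<close>

locale nonassoc_algebra = vector_space scale
  for scale :: "'f::field \<Rightarrow> 'a::ab_group_add \<Rightarrow> 'a" (infixr \<open>*s\<close> 75) +
  fixes mult :: "'a \<Rightarrow> 'a \<Rightarrow> 'a" (infixl \<open>\<star>\<close> 70)
  assumes mult_add_left: "(x + y) \<star> z = x \<star> z + y \<star> z"
    and mult_add_right: "x \<star> (y + z) = x \<star> y + x \<star> z"
    and mult_scale_left: "(c *s x) \<star> y = c *s (x \<star> y)"
    and mult_scale_right: "x \<star> (c *s y) = c *s (x \<star> y)"
begin

definition subalgebra :: "'a set \<Rightarrow> bool" where
  "subalgebra S \<longleftrightarrow> subspace S \<and> (\<forall>x\<in>S. \<forall>y\<in>S. x \<star> y \<in> S)"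

definition gen_subalgebra :: "'a set \<Rightarrow> 'a set" where
  "gen_subalgebra X = subalgebra hull X"

definition algebra_automorphism :: "('a \<Rightarrow> 'a) \<Rightarrow> bool" where
  "algebra_automorphism \<phi> \<longleftrightarrow>
     bij \<phi> \<and> Vector_Spaces.linear scale scale \<phi> \<and> (\<forall>x y. \<phi> (x \<star> y) = \<phi> x \<star> \<phi> y)"

text \<open>Sum (not necessarily direct) of a possibly infinite family of subspaces.\<close>

definition family_sum :: "('i \<Rightarrow> 'a set) \<Rightarrow> 'i set \<Rightarrow> 'a set" where
  "family_sum V I = {\<Sum>i\<in>J. v i | J v. finite J \<and> J \<subseteq> I \<and> (\<forall>i\<in>J. v i \<in> V i)}"


subsection \<open>Primitive axes\<close>

definition zero_part :: "'a set \<Rightarrow> 'a \<Rightarrow> 'a set" where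
  "zero_part B a = {y \<in> B. a \<star> y = 0 \<and> y \<star> a = 0}"

definition odd_part :: "'a set \<Rightarrow> 'f \<Rightarrow> 'f \<Rightarrow> 'a \<Rightarrow> 'a set" where
  "odd_part B l d a = {y \<in> B. a \<star> y = l *s y \<and> y \<star> a = d *s y}"

definition even_part :: "'a set \<Rightarrow> 'a \<Rightarrow> 'a set" where
  "even_part B a = {p + z | p z. p \<in> span {a} \<and> z \<in> zero_part B a}"

definition axis_of_type :: "'a set \<Rightarrow> 'f \<Rightarrow> 'f \<Rightarrow> 'a \<Rightarrow> bool" where
  "axis_of_type B l d a \<longleftrightarrow>
     l \<notin> {0, 1} \<and> d \<notin> {0, 1} \<and>
     a \<in> B \<and> a \<noteq> 0 \<and> a \<star> a = a \<and>
     {y \<in> B. a \<star> y = y} = span {a} \<and> {y \<in> B. y \<star> a = y} = span {a} \<and>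
     (\<forall>v\<in>B. \<exists>!t. t \<in> span {a} \<times> zero_part B a \<times> odd_part B l d a \<and>
                 (case t of (p, z, w) \<Rightarrow> v = p + z + w)) \<and>
     (\<forall>x\<in>even_part B a. \<forall>y\<in>even_part B a. x \<star> y \<in> even_part B a) \<and>
     (\<forall>x\<in>even_part B a. \<forall>y\<in>odd_part B l d a. x \<star> y \<in> odd_part B l d a) \<and>
     (\<forall>x\<in>odd_part B l d a. \<forall>y\<in>even_part B a. x \<star> y \<in> odd_part B l d a) \<and>
     (\<forall>x\<in>odd_part B l d a. \<forall>y\<in>odd_part B l d a. x \<star> y \<in> even_part B a)"

definition primitive_axis :: "'a set \<Rightarrow> 'a \<Rightarrow> bool" where
  "primitive_axis B a \<longleftrightarrow> (\<exists>l d. axis_of_type B l d a)"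

text \<open>
  A type is assigned to every primitive axis \<open>a\<close> of every subalgebra \<open>B\<close>. The assignment
  is forced when the odd part of \<open>a\<close> is nonzero. When the odd part vanishes, \<open>a\<close> is an axis
  of every type and one is selected, subject to the convention that a noncommutative
  type \<open>(l, d)\<close> satisfies \<open>l + d = 1\<close>. For axes with nonzero odd part that equation is
  not imposed here, since it is a theorem for algebras generated by primitive axes and can
  fail in other subalgebras.
\<close>

definition type_choice :: "('a set \<Rightarrow> 'a \<Rightarrow> 'f \<times> 'f) \<Rightarrow> bool" where
  "type_choice ty \<longleftrightarrow>
     (\<forall>B a. subalgebra B \<and> primitive_axis B a \<longrightarrow>
        (\<exists>l d. ty B a = (l, d) \<and> axis_of_type B l d a \<and>
               (odd_part B l d a = {0} \<and> l \<noteq> d \<longrightarrow> l + d = 1)))"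

lemma ex_type_choice: "\<exists>ty. type_choice ty"
proof -
  have "\<exists>t. axis_of_type B (fst t) (snd t) a \<and>
          (odd_part B (fst t) (snd t) a = {0} \<and> fst t \<noteq> snd t \<longrightarrow> fst t + snd t = 1)"
    if B: "subalgebra B" and a: "primitive_axis B a" for B a
  proof -
    from a obtain l d where ax: "axis_of_type B l d a"
      by (auto simp: primitive_axis_def)
    show ?thesis
    proof (cases "odd_part B l d a = {0}")
      case False
      with ax show ?thesis by (intro exI[of _ "(l, d)"]) simp
    next
      case True
      have "odd_part B l l a = {0}"
      proof -
        have "y = 0" if y: "y \<in> odd_part B l l a" for y
        proof -
          have l: "l \<noteq> 0" "l \<noteq> 1" and idem: "a \<star> a = a"
            using ax by (auto simp: axis_of_type_def)
          have yB: "y \<in> B" and ay: "a \<star> y = l *s y"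
            using y by (auto simp: odd_part_def)
          from ax yB obtain p z w where p: "p \<in> span {a}"
            and z: "z \<in> zero_part B a" and w: "w \<in> odd_part B l d a" and "y = p + z + w"
            unfolding axis_of_type_def by (fastforce dest!: bspec[of _ _ y] ex1_implies_ex)
          with True have yd: "y = p + z" by auto
          obtain k where k: "p = k *s a"
            using p by (auto simp: span_singleton)
          have ap: "a \<star> p = p" by (simp add: k mult_scale_right idem)
          have az: "a \<star> z = 0" using z by (simp add: zero_part_def)
          have e: "p = l *s p + l *s z"
            using ay by (simp add: yd mult_add_right ap az scale_right_distrib)
          have "a \<star> p = l *s (a \<star> p) + l *s (a \<star> z)"
            by (subst e) (simp add: mult_add_right mult_scale_right)
          hence "p = l *s p" by (simp add: ap az)
          hence "(1 - l) *s p = 0" by (simp add: scale_left_diff_distrib)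
          with l have p0: "p = 0" by simp
          with e l have "z = 0" by simp
          with p0 yd show ?thesis by simp
        qed
        moreover have "0 \<in> odd_part B l l a"
        proof -
          have "0 \<in> odd_part B l d a" using True by simp
          thus ?thesis by (simp add: odd_part_def)
        qed
        ultimately show ?thesis by blast
      qed
      with True ax have "axis_of_type B l l a"
        by (simp add: axis_of_type_def)
      thus ?thesis by (intro exI[of _ "(l, l)"]) simp
    qed
  qed
  then obtain ty where ty: "\<And>B a. subalgebra B \<Longrightarrow> primitive_axis B a \<Longrightarrow>
      axis_of_type B (fst (ty B a)) (snd (ty B a)) a \<and>
      (odd_part B (fst (ty B a)) (snd (ty B a)) a = {0} \<and> fst (ty B a) \<noteq> snd (ty B a)
        \<longrightarrow> fst (ty B a) + snd (ty B a) = 1)"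
    by metis
  have "type_choice ty"
    unfolding type_choice_def using ty by (metis prod.collapse)
  thus ?thesis by blast
qed


subsection \<open>Miyamoto involutions\<close>

definition miyamoto :: "('a set \<Rightarrow> 'a \<Rightarrow> 'f \<times> 'f) \<Rightarrow> 'a \<Rightarrow> 'a \<Rightarrow> 'a" where
  "miyamoto ty a = (THE \<tau>. algebra_automorphism \<tau> \<and>
     (\<forall>v\<in>even_part UNIV a. \<tau> v = v) \<and>
     (\<forall>v\<in>odd_part UNIV (fst (ty UNIV a)) (snd (ty UNIV a)) a. \<tau> v = - v))"

definition miyamoto_group :: "('a set \<Rightarrow> 'a \<Rightarrow> 'f \<times> 'f) \<Rightarrow> 'a set \<Rightarrow> ('a \<Rightarrow> 'a) set" where
  "miyamoto_group ty X = generate (BijGroup UNIV) (miyamoto ty ` X)"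

definition axis_closure :: "('a set \<Rightarrow> 'a \<Rightarrow> 'f \<times> 'f) \<Rightarrow> 'a set \<Rightarrow> 'a set" where
  "axis_closure ty X = {\<rho> x | \<rho> x. x \<in> X \<and> \<rho> \<in> miyamoto_group ty X}"


subsection \<open>The axial graph\<close>

text \<open>
  The edge relation is symmetric: if \<open>x \<star> y = 0\<close> then \<open>y\<close> lies in the zero part of \<open>x\<close>,
  because the other left eigenvalues of \<open>x\<close> are nonzero.
\<close>

definition axial_graph :: "('a \<times> 'a) set" where
  "axial_graph =
     {(x, y). primitive_axis UNIV x \<and> primitive_axis UNIV y \<and> x \<noteq> y \<and> x \<star> y \<noteq> 0}"

definition axial_components :: "'a set \<Rightarrow> 'a set set" where
  "axial_components S = S // (axial_graph \<inter> S \<times> S)\<^sup>*"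


subsection \<open>Uniform generation\<close>

definition uniform :: "('a \<Rightarrow> 'f \<times> 'f) \<Rightarrow> 'a set \<Rightarrow> bool" where
  "uniform t Y \<longleftrightarrow>
     (\<exists>l. \<forall>y\<in>Y. t y = (l, l)) \<or>
     (\<exists>l d. l \<noteq> d \<and> (\<forall>y\<in>Y. t y = (l, d) \<or> t y = (d, l)))"

definition uniformly_generated :: "('a set \<Rightarrow> 'a \<Rightarrow> 'f \<times> 'f) \<Rightarrow> 'a set \<Rightarrow> bool" where
  "uniformly_generated ty B \<longleftrightarrow>
     (\<exists>Y. (\<forall>y\<in>Y. primitive_axis B y) \<and> uniform (ty B) Y \<and> gen_subalgebra Y = B)"

end

end

theory Submission
  imports Defs
begin

text \<open>
  For axes \<open>x\<close>, \<open>y\<close> write \<open>y = \<alpha> x + z + w\<close> with \<open>z\<close> in the zero part and \<open>w\<close> in the odd part of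
  \<open>x\<close>; then \<open>w = (y - \<tau>\<^sub>x y) / 2\<close>, so the span of \<open>Cl(X)\<close> is closed under multiplication by the axes in
  \<open>Cl(X)\<close> and hence is all of \<open>A\<close>. This gives the sum decomposition.

  Comparing parities in \<open>y y = y\<close>, \<open>y (x y)\<close> and \<open>(x y)(x y)\<close> shows that adjacent axes have the same
  type up to order, or commutative types \<open>l\<close> and \<open>m = 1 - l\<close>. The second case is the only obstacle to
  uniformity. In it \<open>2\<beta> = 1 + l\<close>, where \<open>\<beta>\<close> is the \<open>y\<close>-coefficient of \<open>x\<close>, and \<open>y\<close> lies in the
  algebra generated by \<open>x\<close> and \<open>\<tau>\<^sub>y x\<close> as soon as \<open>\<beta> \<noteq> 0\<close>, that is, \<open>l \<noteq> -1\<close>. Since \<open>l\<close> and \<open>1 - l\<close>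
  are not both \<open>-1\<close>, one may choose \<open>l \<noteq> -1\<close>. The axes of type \<open>l\<close> then generate
  \<open>A\<^sub>i\<close>, because every axis of type \<open>m\<close> in the component is adjacent to one of type \<open>l\<close>:
  if \<open>x \<sim> c \<sim> y\<close> with \<open>x\<close> of type \<open>l\<close> and \<open>c\<close>, \<open>y\<close> of type \<open>m\<close>, then \<open>y\<close> is adjacent to \<open>x\<close> or \<open>\<tau>\<^sub>c x\<close>.
\<close>

context nonassoc_algebra
begin

section \<open>Bilinearity of the product and generated subalgebras\<close>

lemma mult_zero_left [simp]: "0 \<star> x = 0"
  using mult_scale_left[of 0 0 x] by simp

lemma mult_zero_right [simp]: "x \<star> 0 = 0"
  using mult_scale_right[of x 0 0] by simp

lemma mult_minus_left: "(- x) \<star> y = - (x \<star> y)"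
  using mult_add_left[of x "- x" y] by (simp add: eq_neg_iff_add_eq_0 add.commute)

lemma mult_minus_right: "x \<star> (- y) = - (x \<star> y)"
  using mult_add_right[of x y "- y"] by (simp add: eq_neg_iff_add_eq_0 add.commute)

lemma mult_diff_left: "(x - y) \<star> z = x \<star> z - y \<star> z"
  using mult_add_left[of x "- y" z] by (simp add: mult_minus_left)

lemma mult_diff_right: "x \<star> (y - z) = x \<star> y - x \<star> z"
  using mult_add_right[of x y "- z"] by (simp add: mult_minus_right)

lemmas alg_simps = mult_add_left mult_add_right mult_diff_left mult_diff_right
  mult_scale_left mult_scale_right scale_right_distrib scale_right_diff_distrib

lemma gen_subalgebra_subalgebra: "subalgebra (gen_subalgebra X)"
  unfolding gen_subalgebra_def
  by (rule hull_in) (auto simp: subalgebra_def intro!: subspace_Inter)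

lemma gen_subalgebra_superset: "X \<subseteq> gen_subalgebra X"
  unfolding gen_subalgebra_def by (rule hull_subset)

lemma gen_subalgebra_minimal: "X \<subseteq> S \<Longrightarrow> subalgebra S \<Longrightarrow> gen_subalgebra X \<subseteq> S"
  unfolding gen_subalgebra_def by (rule hull_minimal)

lemma subalgebra_UNIV: "subalgebra UNIV"
  by (simp add: subalgebra_def)


subsection \<open>Decomposition with respect to an axis\<close>

lemma axis_idem: "axis_of_type B l d a \<Longrightarrow> a \<star> a = a"
  and axis_nonzero: "axis_of_type B l d a \<Longrightarrow> a \<noteq> 0"
  and axis_type_ne: "axis_of_type B l d a \<Longrightarrow> l \<noteq> 0 \<and> l \<noteq> 1 \<and> d \<noteq> 0 \<and> d \<noteq> 1"
  by (auto simp: axis_of_type_def)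

lemma axis_eigenspace_1:
  assumes "axis_of_type B l d a"
  shows "{y \<in> B. a \<star> y = y} = span {a}" "{y \<in> B. y \<star> a = y} = span {a}"
  using assms unfolding axis_of_type_def by - (elim conjE, assumption)+

lemma zero_partD: "z \<in> zero_part B a \<Longrightarrow> a \<star> z = 0" "z \<in> zero_part B a \<Longrightarrow> z \<star> a = 0"
  and odd_partD: "w \<in> odd_part B l d a \<Longrightarrow> a \<star> w = l *s w" "w \<in> odd_part B l d a \<Longrightarrow> w \<star> a = d *s w"
  by (simp_all add: zero_part_def odd_part_def)

lemma subspace_zero_part: "subspace (zero_part UNIV a)"
  by (rule subspaceI) (simp_all add: zero_part_def alg_simps)

lemma subspace_odd_part: "subspace (odd_part UNIV l d a)"
  by (rule subspaceI) (simp_all add: odd_part_def alg_simps ac_simps)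

lemma even_partI: "z \<in> zero_part B a \<Longrightarrow> k *s a + z \<in> even_part B a"
  unfolding even_part_def by (auto simp: span_singleton)

lemma even_partE:
  assumes "e \<in> even_part B a"
  obtains k z where "e = k *s a + z" "z \<in> zero_part B a"
  using assms unfolding even_part_def by (auto simp: span_singleton)

lemma subspace_even_part: "subspace (even_part UNIV a)"
proof -
  have "even_part UNIV a = {x + y |x y. x \<in> span {a} \<and> y \<in> zero_part UNIV a}"
    by (simp add: even_part_def)
  thus ?thesis using subspace_sums[OF subspace_span subspace_zero_part] by simp
qed

lemma zero_part_even: "z \<in> zero_part UNIV a \<Longrightarrow> z \<in> even_part UNIV a"
  using even_partI[of z UNIV a 0] by simp

lemma axis_even: "a \<in> even_part UNIV a"
  using even_partI[of 0 UNIV a 1] by (simp add: zero_part_def)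

lemma axis_fusion:
  assumes "axis_of_type B l d a"
  shows "x \<in> even_part B a \<Longrightarrow> y \<in> even_part B a \<Longrightarrow> x \<star> y \<in> even_part B a"
    and "x \<in> even_part B a \<Longrightarrow> y \<in> odd_part B l d a \<Longrightarrow> x \<star> y \<in> odd_part B l d a"
    and "x \<in> odd_part B l d a \<Longrightarrow> y \<in> even_part B a \<Longrightarrow> x \<star> y \<in> odd_part B l d a"
    and "x \<in> odd_part B l d a \<Longrightarrow> y \<in> odd_part B l d a \<Longrightarrow> x \<star> y \<in> even_part B a"
  using assms unfolding axis_of_type_def by blast+

lemma axis_decomp:
  assumes "axis_of_type B l d a" "v \<in> B"
  obtains k z w where "v = k *s a + z + w" "z \<in> zero_part B a" "w \<in> odd_part B l d a"
proof -
  from assms obtain t where t: "t \<in> span {a} \<times> zero_part B a \<times> odd_part B l d a"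
      "case t of (p, z, w) \<Rightarrow> v = p + z + w"
    unfolding axis_of_type_def by (meson ex1_implies_ex)
  obtain p z w where "t = (p, z, w)" by (cases t)
  with t that show ?thesis by (auto simp: span_singleton)
qed

section \<open>Independence and uniqueness of the three components\<close>

text \<open>Left multiplication by \<open>a\<close> acts on the three terms with the distinct
  eigenvalues 1, 0 and \<open>l\<close>; applying it twice removes \<open>z\<close> and separates
  the other two. Only eigenvector equations are assumed, so the lemma serves axes of any
  carrier.\<close>

lemma axis_independent:
  assumes a: "a \<noteq> 0" "a \<star> a = a" and l: "l \<noteq> 0" "l \<noteq> 1"
    and z: "a \<star> z = 0" and w: "a \<star> w = l *s w" and eq: "k *s a + z + w = 0"
  shows "k = 0 \<and> z = 0 \<and> w = 0"
proof -
  have "a \<star> (k *s a + z + w) = 0" by (simp only: eq mult_zero_right)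
  hence 1: "k *s a + l *s w = 0" by (simp add: alg_simps a z w)
  have "a \<star> (k *s a + l *s w) = 0" by (simp only: 1 mult_zero_right)
  hence 2: "k *s a + (l * l) *s w = 0" by (simp add: alg_simps a w)
  have "(l * l) *s w = l *s w" using 1 2 by (metis add_left_imp_eq)
  hence "(l * l - l) *s w = 0" by (simp add: scale_left_diff_distrib)
  moreover have "l * l - l \<noteq> 0" using l by simp
  ultimately have w0: "w = 0" by simp
  hence "k = 0" using 1 a by simp
  thus ?thesis using w0 eq by simp
qed

lemma axis_coeffs_unique:
  assumes ax: "axis_of_type UNIV l d a"
    and "z \<in> zero_part UNIV a" "w \<in> odd_part UNIV l d a"
    and "z' \<in> zero_part UNIV a" "w' \<in> odd_part UNIV l d a"
    and eq: "k *s a + z + w = k' *s a + z' + w'"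
  shows "k = k' \<and> z = z' \<and> w = w'"
proof -
  have "(k - k') *s a + (z - z') + (w - w') = 0"
    using eq by (simp add: scale_left_diff_distrib algebra_simps)
  moreover have "a \<star> (z - z') = 0" using assms(2,4) by (simp add: zero_part_def mult_diff_right)
  moreover have "a \<star> (w - w') = l *s (w - w')"
    using assms(3,5) by (simp add: odd_part_def alg_simps)
  ultimately have "k - k' = 0 \<and> z - z' = 0 \<and> w - w' = 0"
    using axis_independent axis_idem[OF ax] axis_nonzero[OF ax] axis_type_ne[OF ax] by blast
  thus ?thesis by simp
qed

lemma even_odd_unique:
  assumes ax: "axis_of_type UNIV l d a"
    and "e \<in> even_part UNIV a" "w \<in> odd_part UNIV l d a"
    and "e' \<in> even_part UNIV a" "w' \<in> odd_part UNIV l d a"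
    and eq: "e + w = e' + w'"
  shows "e = e' \<and> w = w'"
proof -
  obtain k z k' z' where "e = k *s a + z" "z \<in> zero_part UNIV a" "e' = k' *s a + z'" "z' \<in> zero_part UNIV a"
    using assms(2,4) by (elim even_partE)
  with axis_coeffs_unique[OF ax, of z w z' w' k k'] assms(3,5) eq show ?thesis by simp
qed

lemma even_odd_eq_0:
  assumes "axis_of_type UNIV l d a" "w \<in> even_part UNIV a" "w \<in> odd_part UNIV l d a"
  shows "w = 0"
  using even_odd_unique[OF assms(1), of w 0 0 w] assms(2,3)
    subspace_0[OF subspace_even_part] subspace_0[OF subspace_odd_part] by simp

text \<open>By the grading, \<open>w = w \<star> w\<close> is even as well as odd.\<close>

lemma odd_idem_eq_0:
  assumes "axis_of_type UNIV l d a" "w \<in> odd_part UNIV l d a" "w \<star> w = w"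
  shows "w = 0"
  using axis_fusion(4)[OF assms(1,2,2)] assms even_odd_eq_0 by metis

lemma axis_even_odd:
  assumes "axis_of_type UNIV l d a"
  obtains e w where "v = e + w" "e \<in> even_part UNIV a" "w \<in> odd_part UNIV l d a"
  by (metis UNIV_I assms axis_decomp even_partI)

text \<open>Left multiplication by \<open>a\<close> has eigenvalue 0 on the zero part and
  \<open>l\<close> on the odd part, so both these components of \<open>v\<close> vanish. The value
  \<open>c = 1\<close> is covered; for any other \<open>c\<close> the vector is in fact
  zero.\<close>

lemma axis_left_eigenvector:
  assumes ax: "axis_of_type UNIV l d a" and v: "a \<star> v = c *s v" and c: "c \<noteq> 0" "c \<noteq> l"
  shows "v \<in> span {a}"
proof -
  obtain k z w where d: "v = k *s a + z + w" "z \<in> zero_part UNIV a" "w \<in> odd_part UNIV l d a"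
    using axis_decomp[OF ax UNIV_I] .
  have "a \<star> v = k *s a + 0 + l *s w"
    using d(2,3) by (simp add: d(1) alg_simps axis_idem[OF ax] zero_partD odd_partD)
  hence "k *s a + 0 + l *s w = (c * k) *s a + c *s z + c *s w"
    using v by (simp add: d(1) alg_simps)
  hence "0 = c *s z \<and> l *s w = c *s w"
    using axis_coeffs_unique[OF ax] subspace_scale[OF subspace_zero_part]
      subspace_scale[OF subspace_odd_part] subspace_0[OF subspace_zero_part] d(2,3) by blast
  hence "z = 0" "w = 0" using c by auto
  thus ?thesis by (auto simp: d(1) span_singleton)
qed

section \<open>Uniqueness of types and restriction to subalgebras\<close>

text \<open>A nonzero odd vector is an eigenvector of both multiplications by \<open>a\<close>, and
  decomposing it with respect to the second type shows that it is odd there too. This determines the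
  chosen type of an axis whose odd part is nonzero.\<close>

lemma axis_type_unique:
  assumes ax: "axis_of_type B l d a" "axis_of_type B l' d' a"
    and w: "w \<in> odd_part B l d a" "w \<noteq> 0"
  shows "l' = l \<and> d' = d"
proof -
  have wB: "w \<in> B" using w by (simp add: odd_part_def)
  obtain k z u where d: "w = k *s a + z + u" "z \<in> zero_part B a" "u \<in> odd_part B l' d' a"
    using axis_decomp[OF ax(2) wB] .
  have aw: "a \<star> w = l *s w" "w \<star> a = d *s w" using w by (simp_all add: odd_partD)
  have "a \<star> w = k *s a + l' *s u"
    using d(2,3) by (simp add: d(1) alg_simps axis_idem[OF ax(1)] zero_partD odd_partD)
  hence "(l * k - k) *s a + l *s z + (l - l') *s u = 0"
    using aw(1) by (simp add: d(1) alg_simps scale_left_diff_distrib algebra_simps)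
  moreover have "a \<star> (l *s z) = 0" "a \<star> ((l - l') *s u) = l' *s ((l - l') *s u)"
    using d(2,3) by (simp_all add: zero_partD odd_partD mult_scale_right mult.commute)
  ultimately have *: "l * k - k = 0 \<and> l *s z = 0 \<and> (l - l') *s u = 0"
    using axis_independent axis_idem[OF ax(2)] axis_nonzero[OF ax(2)] axis_type_ne[OF ax(2)] by blast
  have l: "l \<noteq> 0" "l \<noteq> 1" using axis_type_ne[OF ax(1)] by auto
  have "(l - 1) * k = 0" using * by (simp add: algebra_simps)
  hence "k = 0" using l by simp
  moreover have "z = 0" using * l by simp
  ultimately have wu: "w = u" using d(1) by simp
  hence "l = l'" using * w by simp
  moreover have "d = d'" using aw(2) d(3) wu w(2) by (auto simp: odd_part_def)
  ultimately show ?thesis by simp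
qed

text \<open>The components of \<open>v\<close> arise from \<open>v\<close> and \<open>a\<close> by
  products and linear combinations, hence stay in \<open>B\<close>. Thus each part relative to
  \<open>B\<close> is the intersection of the full part with \<open>B\<close>, and the axis
  conditions are inherited.\<close>

lemma axis_restrict:
  assumes ax: "axis_of_type UNIV l d a" and B: "subalgebra B" and a: "a \<in> B"
  shows "axis_of_type B l d a"
proof -
  have sB: "subspace B" and mB: "\<And>x y. x \<in> B \<Longrightarrow> y \<in> B \<Longrightarrow> x \<star> y \<in> B"
    using B by (auto simp: subalgebra_def)
  have spB: "span {a} \<subseteq> B" using a sB by (simp add: span_minimal)
  have l: "l \<noteq> 0" "l \<noteq> 1" using axis_type_ne[OF ax] by auto
  have zp: "zero_part B a = zero_part UNIV a \<inter> B" by (auto simp: zero_part_def)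
  have op: "odd_part B l d a = odd_part UNIV l d a \<inter> B" by (auto simp: odd_part_def)
  have ep: "even_part B a = even_part UNIV a \<inter> B"
  proof
    show "even_part B a \<subseteq> even_part UNIV a \<inter> B"
      using spB subspace_add[OF sB] unfolding even_part_def zp by blast
    show "even_part UNIV a \<inter> B \<subseteq> even_part B a"
    proof
      fix e assume e: "e \<in> even_part UNIV a \<inter> B"
      then obtain p z where pz: "e = p + z" "p \<in> span {a}" "z \<in> zero_part UNIV a"
        by (auto simp: even_part_def)
      have "z = e - p" using pz by simp
      hence "z \<in> B" using e pz(2) spB subspace_diff[OF sB] by auto
      thus "e \<in> even_part B a" using pz unfolding even_part_def zp by blast
    qed
  qed
  have dec: "\<exists>!t. t \<in> span {a} \<times> zero_part B a \<times> odd_part B l d a \<and>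
                 (case t of (p, z, w) \<Rightarrow> v = p + z + w)" if v: "v \<in> B" for v
  proof -
    obtain k z w where dv: "v = k *s a + z + w" "z \<in> zero_part UNIV a" "w \<in> odd_part UNIV l d a"
      using axis_decomp[OF ax UNIV_I] .
    have av: "a \<star> v = k *s a + l *s w"
      using dv(2,3) by (simp add: dv(1) alg_simps axis_idem[OF ax] zero_partD odd_partD)
    \<comment> \<open>The polynomial \<open>t - t * t\<close> vanishes at the eigenvalues 0 and 1
      but not at \<open>l\<close>, so up to a nonzero factor it projects onto the odd
      component.\<close>
    have "a \<star> v - a \<star> (a \<star> v) = (l - l * l) *s w"
      using dv(3) by (simp add: av alg_simps axis_idem[OF ax] odd_partD scale_left_diff_distrib)
    moreover have "a \<star> v - a \<star> (a \<star> v) \<in> B" using a v by (intro subspace_diff[OF sB] mB)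
    ultimately have "(1 / (l - l * l)) *s ((l - l * l) *s w) \<in> B" using subspace_scale[OF sB] by metis
    hence wB: "w \<in> B" using l by simp
    have "k *s a \<in> B" using a subspace_scale[OF sB] by blast
    moreover have "z = v - k *s a - w" using dv(1) by simp
    ultimately have "z \<in> B" using v wB subspace_diff[OF sB] by auto
    with dv wB have in_B: "(k *s a, z, w) \<in> span {a} \<times> zero_part B a \<times> odd_part B l d a \<and>
                 (case (k *s a, z, w) of (p, z, w) \<Rightarrow> v = p + z + w)"
      by (auto simp: zp op span_singleton)
    show ?thesis
    proof (rule ex1I, rule in_B)
      fix t assume t: "t \<in> span {a} \<times> zero_part B a \<times> odd_part B l d a \<and>
        (case t of (p, z, w) \<Rightarrow> v = p + z + w)"
      obtain p' z' w' where tt: "t = (p', z', w')" by (cases t)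
      obtain k' where p': "p' = k' *s a" using t tt by (auto simp: span_singleton)
      have "k' = k \<and> z' = z \<and> w' = w"
        using axis_coeffs_unique[OF ax, of z' w' z w k' k] t dv by (simp add: tt p' zp op)
      thus "t = (k *s a, z, w)" by (simp add: tt p')
    qed
  qed
  have eigen: "\<And>y. a \<star> y = y \<longleftrightarrow> y \<in> span {a}" "\<And>y. y \<star> a = y \<longleftrightarrow> y \<in> span {a}"
    using axis_eigenspace_1[OF ax] by auto
  have "{y \<in> B. a \<star> y = y} = span {a}" "{y \<in> B. y \<star> a = y} = span {a}"
    using eigen spB by auto
  moreover have "\<forall>x\<in>even_part B a. \<forall>y\<in>even_part B a. x \<star> y \<in> even_part B a"
    "\<forall>x\<in>even_part B a. \<forall>y\<in>odd_part B l d a. x \<star> y \<in> odd_part B l d a"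
    "\<forall>x\<in>odd_part B l d a. \<forall>y\<in>even_part B a. x \<star> y \<in> odd_part B l d a"
    "\<forall>x\<in>odd_part B l d a. \<forall>y\<in>odd_part B l d a. x \<star> y \<in> even_part B a"
    by (simp_all add: ep op mB axis_fusion[OF ax])
  moreover have types: "l \<notin> {0, 1}" "d \<notin> {0, 1}" using axis_type_ne[OF ax] by auto
  ultimately show ?thesis
    unfolding axis_of_type_def
    by - (intro conjI; (assumption | rule types a axis_nonzero[OF ax] axis_idem[OF ax] | rule ballI, rule dec, assumption))
qed


subsection \<open>Automorphisms and Miyamoto involutions\<close>

lemma automorphismD:
  assumes "algebra_automorphism \<phi>"
  shows "\<phi> (x + y) = \<phi> x + \<phi> y" "\<phi> (c *s x) = c *s \<phi> x" "\<phi> (x \<star> y) = \<phi> x \<star> \<phi> y"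
    "\<phi> x = \<phi> y \<longleftrightarrow> x = y" "\<phi> 0 = 0" "\<phi> (- x) = - \<phi> x"
proof -
  have lin: "Vector_Spaces.linear scale scale \<phi>" using assms by (simp add: algebra_automorphism_def)
  interpret Vector_Spaces.linear scale scale \<phi> by (rule lin)
  show "\<phi> (x + y) = \<phi> x + \<phi> y" by (rule add)
  show "\<phi> (c *s x) = c *s \<phi> x" by (rule scale)
  show "\<phi> 0 = 0" by (rule zero)
  show "\<phi> (- x) = - \<phi> x" by (rule neg)
  show "\<phi> (x \<star> y) = \<phi> x \<star> \<phi> y" using assms by (simp add: algebra_automorphism_def)
  show "\<phi> x = \<phi> y \<longleftrightarrow> x = y" using assms by (auto simp: algebra_automorphism_def bij_def inj_eq)
qed

lemma automorphism_surj: "algebra_automorphism \<phi> \<Longrightarrow> \<exists>x. y = \<phi> x"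
  by (meson algebra_automorphism_def bij_pointE)

lemma automorphism_comp:
  "algebra_automorphism \<phi> \<Longrightarrow> algebra_automorphism \<psi> \<Longrightarrow> algebra_automorphism (\<phi> \<circ> \<psi>)"
  unfolding algebra_automorphism_def
  by (auto intro: bij_comp Vector_Spaces.linear_compose)

lemma automorphism_in_parts:
  assumes "algebra_automorphism \<phi>"
  shows "\<phi> y \<in> zero_part UNIV (\<phi> a) \<longleftrightarrow> y \<in> zero_part UNIV a"
    and "\<phi> y \<in> odd_part UNIV l d (\<phi> a) \<longleftrightarrow> y \<in> odd_part UNIV l d a"
  unfolding zero_part_def odd_part_def
  using automorphismD(2-5)[OF assms] by (simp_all flip: automorphismD(2-3)[OF assms])
     (metis automorphismD(4,5)[OF assms])

lemma automorphism_span_singleton: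
  assumes "algebra_automorphism \<phi>"
  shows "\<phi> y \<in> span {\<phi> a} \<longleftrightarrow> y \<in> span {a}"
  by (auto simp: span_singleton automorphismD(4)[OF assms] simp flip: automorphismD(2)[OF assms])

lemma automorphism_in_even:
  assumes "algebra_automorphism \<phi>"
  shows "\<phi> y \<in> even_part UNIV (\<phi> a) \<longleftrightarrow> y \<in> even_part UNIV a"
proof
  assume "\<phi> y \<in> even_part UNIV (\<phi> a)"
  then obtain k z where k: "\<phi> y = k *s \<phi> a + z" "z \<in> zero_part UNIV (\<phi> a)" by (elim even_partE)
  obtain z' where z': "z = \<phi> z'" using automorphism_surj[OF assms] by blast
  have "\<phi> y = \<phi> (k *s a + z')" by (simp add: k z' automorphismD(1,2)[OF assms])
  hence "y = k *s a + z'" by (simp add: automorphismD(4)[OF assms])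
  thus "y \<in> even_part UNIV a"
    using k(2) by (simp add: z' automorphism_in_parts[OF assms] even_partI)
next
  assume "y \<in> even_part UNIV a"
  then obtain k z where k: "y = k *s a + z" "z \<in> zero_part UNIV a" by (elim even_partE)
  thus "\<phi> y \<in> even_part UNIV (\<phi> a)"
    by (simp add: automorphismD(1,2)[OF assms] even_partI automorphism_in_parts(1)[OF assms])
qed

lemma automorphism_axis:
  assumes \<phi>: "algebra_automorphism \<phi>" and ax: "axis_of_type UNIV l d a"
  shows "axis_of_type UNIV l d (\<phi> a)"
proof -
  note simps = automorphism_in_parts[OF \<phi>] automorphism_in_even[OF \<phi>] automorphism_span_singleton[OF \<phi>]
    automorphismD(3)[OF \<phi>, symmetric] automorphismD(4)[OF \<phi>]
  \<comment> \<open>Surjectivity lets quantifiers range over images under \<open>\<phi>\<close>,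
    which reduces the eigenspace and fusion conditions for \<open>\<phi> a\<close> to those for
    \<open>a\<close>.\<close>
  have all: "(\<forall>y. P y) \<longleftrightarrow> (\<forall>y. P (\<phi> y))" for P
    using automorphism_surj[OF \<phi>] by metis
  have dec: "\<exists>!t. t \<in> span {\<phi> a} \<times> zero_part UNIV (\<phi> a) \<times> odd_part UNIV l d (\<phi> a) \<and>
                 (case t of (p, z, w) \<Rightarrow> v = p + z + w)" for v
  proof -
    obtain u where u: "v = \<phi> u" using automorphism_surj[OF \<phi>] by blast
    obtain k z w where d: "u = k *s a + z + w" "z \<in> zero_part UNIV a" "w \<in> odd_part UNIV l d a"
      using axis_decomp[OF ax UNIV_I] .
    have v: "v = k *s \<phi> a + \<phi> z + \<phi> w"
      by (simp add: u d(1) automorphismD(1,2)[OF \<phi>])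
    show ?thesis
    proof (rule ex1I[of _ "(k *s \<phi> a, \<phi> z, \<phi> w)"])
      show "(k *s \<phi> a, \<phi> z, \<phi> w) \<in> span {\<phi> a} \<times> zero_part UNIV (\<phi> a) \<times> odd_part UNIV l d (\<phi> a) \<and>
                 (case (k *s \<phi> a, \<phi> z, \<phi> w) of (p, z, w) \<Rightarrow> v = p + z + w)"
        using d(2,3) by (auto simp: simps v span_singleton)
    next
      fix t assume t: "t \<in> span {\<phi> a} \<times> zero_part UNIV (\<phi> a) \<times> odd_part UNIV l d (\<phi> a) \<and>
                 (case t of (p, z, w) \<Rightarrow> v = p + z + w)"
      obtain p' z' w' where tt: "t = (p', z', w')" by (cases t)
      obtain k' where p': "p' = k' *s \<phi> a" using t tt by (auto simp: span_singleton)
      obtain z2 w2 where z2: "z' = \<phi> z2" and w2: "w' = \<phi> w2" using automorphism_surj[OF \<phi>] by metis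
      have "\<phi> (k' *s a + z2 + w2) = \<phi> u"
        using t by (simp add: tt p' z2 w2 u automorphismD(1,2)[OF \<phi>])
      hence "k' *s a + z2 + w2 = k *s a + z + w" by (simp add: automorphismD(4)[OF \<phi>] d(1))
      moreover have "z2 \<in> zero_part UNIV a" "w2 \<in> odd_part UNIV l d a"
        using t by (auto simp: tt z2 w2 simps)
      ultimately have "k' = k \<and> z2 = z \<and> w2 = w"
        using axis_coeffs_unique[OF ax, of z2 w2 z w k' k] d(2,3) by blast
      thus "t = (k *s \<phi> a, \<phi> z, \<phi> w)" by (simp add: tt p' z2 w2)
    qed
  qed
  have "\<And>y. a \<star> y = y \<longleftrightarrow> y \<in> span {a}" "\<And>y. y \<star> a = y \<longleftrightarrow> y \<in> span {a}"
    using axis_eigenspace_1[OF ax] by auto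
  hence "\<forall>y. \<phi> a \<star> y = y \<longleftrightarrow> y \<in> span {\<phi> a}" "\<forall>y. y \<star> \<phi> a = y \<longleftrightarrow> y \<in> span {\<phi> a}"
    by (subst all, simp add: simps)+
  hence "{y \<in> UNIV. \<phi> a \<star> y = y} = span {\<phi> a}" "{y \<in> UNIV. y \<star> \<phi> a = y} = span {\<phi> a}"
    by auto
  moreover have "\<forall>x\<in>even_part UNIV (\<phi> a). \<forall>y\<in>even_part UNIV (\<phi> a). x \<star> y \<in> even_part UNIV (\<phi> a)"
    "\<forall>x\<in>even_part UNIV (\<phi> a). \<forall>y\<in>odd_part UNIV l d (\<phi> a). x \<star> y \<in> odd_part UNIV l d (\<phi> a)"
    "\<forall>x\<in>odd_part UNIV l d (\<phi> a). \<forall>y\<in>even_part UNIV (\<phi> a). x \<star> y \<in> odd_part UNIV l d (\<phi> a)"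
    "\<forall>x\<in>odd_part UNIV l d (\<phi> a). \<forall>y\<in>odd_part UNIV l d (\<phi> a). x \<star> y \<in> even_part UNIV (\<phi> a)"
    unfolding Ball_def
    by (subst all, rule allI, subst simps, intro impI, subst all, simp add: simps axis_fusion[OF ax])+
  moreover have "\<phi> a \<noteq> 0"
    using axis_nonzero[OF ax] automorphismD(4)[OF \<phi>, of a 0] by (simp add: automorphismD(5)[OF \<phi>])
  moreover have types: "l \<notin> {0, 1}" "d \<notin> {0, 1}" using axis_type_ne[OF ax] by auto
  moreover have idem: "\<phi> a \<star> \<phi> a = \<phi> a" by (simp add: simps axis_idem[OF ax])
  ultimately show ?thesis
    unfolding axis_of_type_def
    by - (intro conjI; (assumption | rule types UNIV_I idem | rule ballI, rule dec))
qed

section \<open>Existence, uniqueness and conjugation of Miyamoto involutions\<close>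

text \<open>The type is an argument instead of being read off from \<open>ty\<close>, so that the
  notion is carried along by automorphisms.\<close>

definition is_miyamoto :: "'f \<Rightarrow> 'f \<Rightarrow> 'a \<Rightarrow> ('a \<Rightarrow> 'a) \<Rightarrow> bool" where
  "is_miyamoto l d a \<tau> \<longleftrightarrow> algebra_automorphism \<tau> \<and>
     (\<forall>v\<in>even_part UNIV a. \<tau> v = v) \<and> (\<forall>v\<in>odd_part UNIV l d a. \<tau> v = - v)"

lemma is_miyamoto_automorphism: "is_miyamoto l d a \<tau> \<Longrightarrow> algebra_automorphism \<tau>"
  by (simp add: is_miyamoto_def)

lemma is_miyamoto_even_odd:
  assumes "is_miyamoto l d a \<tau>" "e \<in> even_part UNIV a" "w \<in> odd_part UNIV l d a"
  shows "\<tau> (e + w) = e - w"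
  using assms by (simp add: is_miyamoto_def automorphismD(1))

lemma is_miyamoto_self: "is_miyamoto l d a \<tau> \<Longrightarrow> \<tau> a = a"
  by (simp add: is_miyamoto_def axis_even)

lemma is_miyamoto_involution:
  assumes "axis_of_type UNIV l d a" "is_miyamoto l d a \<tau>"
  shows "\<tau> (\<tau> v) = v"
proof -
  obtain e w where d: "v = e + w" "e \<in> even_part UNIV a" "w \<in> odd_part UNIV l d a"
    using axis_even_odd[OF assms(1)] .
  have "- w \<in> odd_part UNIV l d a" using subspace_neg[OF subspace_odd_part] d(3) by blast
  thus ?thesis
    using is_miyamoto_even_odd[OF assms(2) d(2), of w] is_miyamoto_even_odd[OF assms(2) d(2), of "- w"] d
    by simp
qed

lemma is_miyamoto_unique:
  assumes "axis_of_type UNIV l d a" "is_miyamoto l d a \<tau>" "is_miyamoto l d a \<sigma>"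
  shows "\<tau> = \<sigma>"
proof
  fix v
  obtain e w where "v = e + w" "e \<in> even_part UNIV a" "w \<in> odd_part UNIV l d a"
    using axis_even_odd[OF assms(1)] .
  thus "\<tau> v = \<sigma> v"
    using is_miyamoto_even_odd[OF assms(2)] is_miyamoto_even_odd[OF assms(3)] by simp
qed

text \<open>Changing the sign of the odd component is multiplicative by the grading, and bijective
  as it is its own inverse.\<close>

lemma is_miyamoto_exists:
  assumes ax: "axis_of_type UNIV l d a"
  shows "\<exists>\<tau>. is_miyamoto l d a \<tau>"
proof -
  let ?E = "even_part UNIV a" and ?O = "odd_part UNIV l d a"
  have "\<forall>v. \<exists>e w. v = e + w \<and> e \<in> ?E \<and> w \<in> ?O" by (metis axis_even_odd[OF ax])
  then obtain p q where pq: "\<And>v. v = p v + q v" "\<And>v. p v \<in> ?E" "\<And>v. q v \<in> ?O"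
    by metis
  define \<tau> where "\<tau> v = p v - q v" for v
  note subE = subspace_add[OF subspace_even_part] subspace_scale[OF subspace_even_part]
    subspace_0[OF subspace_even_part]
  note subO = subspace_add[OF subspace_odd_part] subspace_scale[OF subspace_odd_part]
    subspace_0[OF subspace_odd_part] subspace_neg[OF subspace_odd_part]
  \<comment> \<open>Even-odd splittings are unique, so \<open>\<tau>\<close> can be evaluated on any
    splitting, not only on the chosen \<open>p v + q v\<close>. The laws below exhibit splittings of
    sums, multiples and products.\<close>
  have \<tau>I: "\<tau> (e + w) = e - w" if "e \<in> ?E" "w \<in> ?O" for e w
    using even_odd_unique[OF ax that pq(2,3) pq(1)] by (simp add: \<tau>_def)
  have add: "\<tau> (u + v) = \<tau> u + \<tau> v" for u v
  proof -
    have "\<tau> ((p u + p v) + (q u + q v)) = (p u + p v) - (q u + q v)"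
      by (intro \<tau>I subE subO pq)
    moreover have "(p u + p v) + (q u + q v) = u + v"
      using pq(1)[of u] pq(1)[of v] by (simp add: algebra_simps)
    ultimately show ?thesis by (simp add: \<tau>_def algebra_simps)
  qed
  have scl: "\<tau> (c *s v) = c *s \<tau> v" for c v
  proof -
    have "\<tau> (c *s p v + c *s q v) = c *s p v - c *s q v"
      by (intro \<tau>I subE subO pq)
    thus ?thesis
      using pq(1)[of v] by (metis \<tau>_def scale_right_distrib scale_right_diff_distrib)
  qed
  have mult: "\<tau> (u \<star> v) = \<tau> u \<star> \<tau> v" for u v
  proof -
    have "\<tau> ((p u \<star> p v + q u \<star> q v) + (p u \<star> q v + q u \<star> p v))
        = (p u \<star> p v + q u \<star> q v) - (p u \<star> q v + q u \<star> p v)"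
      by (intro \<tau>I subE subO pq axis_fusion[OF ax])
    moreover have "(p u \<star> p v + q u \<star> q v) + (p u \<star> q v + q u \<star> p v) = (p u + q u) \<star> (p v + q v)"
      by (simp add: alg_simps algebra_simps)
    ultimately have "\<tau> ((p u + q u) \<star> (p v + q v)) = \<tau> u \<star> \<tau> v"
      by (simp add: \<tau>_def alg_simps algebra_simps)
    thus ?thesis by (simp flip: pq(1))
  qed
  have inv: "\<tau> (\<tau> v) = v" for v
    using \<tau>I[of "p v" "- q v"] pq subO by (simp add: \<tau>_def flip: pq(1))
  have "Vector_Spaces.linear scale scale \<tau>"
    by (intro Vector_Spaces.linear.intro vector_space_axioms module_hom.intro
        module_hom_axioms.intro module_axioms) (simp_all add: add scl)
  moreover have "bij \<tau>" using inv by (auto intro: involuntory_imp_bij)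
  moreover have "\<forall>v\<in>?E. \<tau> v = v" using \<tau>I[of _ 0] subO by simp
  moreover have "\<forall>v\<in>?O. \<tau> v = - v" using \<tau>I[of 0] subE by simp
  ultimately have "is_miyamoto l d a \<tau>"
    using mult by (simp add: is_miyamoto_def algebra_automorphism_def)
  thus ?thesis by blast
qed

text \<open>As \<open>\<sigma>\<close> is its own inverse, the map is the conjugate of
  \<open>\<tau>\<close> by \<open>\<sigma>\<close>, and \<open>\<sigma>\<close> carries the parts of
  \<open>a\<close> to those of \<open>\<sigma> a\<close>.\<close>

lemma is_miyamoto_conj:
  assumes \<sigma>: "algebra_automorphism \<sigma>" "\<And>v. \<sigma> (\<sigma> v) = v" and \<tau>: "is_miyamoto l d a \<tau>"
  shows "is_miyamoto l d (\<sigma> a) (\<sigma> \<circ> \<tau> \<circ> \<sigma>)"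
proof -
  have "(\<sigma> \<circ> \<tau> \<circ> \<sigma>) v = v" if "v \<in> even_part UNIV (\<sigma> a)" for v
    using that automorphism_in_even[OF \<sigma>(1), of "\<sigma> v" a] \<tau> by (simp add: is_miyamoto_def \<sigma>(2))
  moreover have "(\<sigma> \<circ> \<tau> \<circ> \<sigma>) v = - v" if "v \<in> odd_part UNIV l d (\<sigma> a)" for v
    using that automorphism_in_parts(2)[OF \<sigma>(1), of "\<sigma> v" l d a] \<tau>
    by (simp add: is_miyamoto_def \<sigma>(2) automorphismD(6)[OF \<sigma>(1)])
  moreover have "algebra_automorphism (\<sigma> \<circ> \<tau> \<circ> \<sigma>)"
    using \<sigma>(1) \<tau> by (intro automorphism_comp) (auto simp: is_miyamoto_def)
  ultimately show ?thesis by (simp add: is_miyamoto_def)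
qed

lemma miyamoto_eq:
  assumes "type_choice ty" "primitive_axis UNIV a"
  obtains l d where "axis_of_type UNIV l d a" "is_miyamoto l d a (miyamoto ty a)"
proof -
  obtain l d where ty: "ty UNIV a = (l, d)" "axis_of_type UNIV l d a"
    using assms subalgebra_UNIV unfolding type_choice_def by blast
  have "\<exists>!\<tau>. is_miyamoto l d a \<tau>"
    using is_miyamoto_exists[OF ty(2)] is_miyamoto_unique[OF ty(2)] by blast
  from theI'[OF this] have "is_miyamoto l d a (miyamoto ty a)"
    by (simp add: miyamoto_def is_miyamoto_def ty(1))
  with ty(2) that show ?thesis by blast
qed


subsection \<open>The closure of a set of axes\<close>

text \<open>Generators are involutions, so an inverted generator is the generator itself and only
  compositions remain.\<close>

lemma miyamoto_group_induct [consumes 2, case_names id generator comp]: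
  assumes "\<forall>x\<in>X. bij (miyamoto ty x) \<and> (\<forall>v. miyamoto ty x (miyamoto ty x v) = v)"
    and "\<rho> \<in> miyamoto_group ty X"
    and "P id" "\<And>x. x \<in> X \<Longrightarrow> P (miyamoto ty x)"
    and "\<And>f g. P f \<Longrightarrow> P g \<Longrightarrow> P (f \<circ> g)"
  shows "P \<rho>"
proof -
  \<comment> \<open>Bijectivity is carried along because the product of \<open>BijGroup\<close> is
    composition on bijections only.\<close>
  have "P \<rho> \<and> bij \<rho>"
    using assms(2) unfolding miyamoto_group_def
  proof (induction rule: generate.induct)
    case one
    have "\<one>\<^bsub>BijGroup UNIV\<^esub> = (id :: 'a \<Rightarrow> 'a)"
      by (auto simp: BijGroup_def)
    thus ?case using assms(3) bij_id by metis
  next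
    case (incl h)
    thus ?case using assms(1,4) by auto
  next
    case (inv h)
    then obtain x where x: "x \<in> X" "h = miyamoto ty x" by auto
    have b: "bij h" "\<And>v. h (h v) = v" using assms(1) x by auto
    have "inv_into UNIV h = h" using b by (metis bij_inv_eq_iff ext)
    hence "inv\<^bsub>BijGroup UNIV\<^esub> h = h"
      using b(1) by (subst inv_BijGroup) (auto simp: Bij_def)
    thus ?case using assms(4)[OF x(1)] x(2) b(1) by simp
  next
    case (eng f g)
    have "f \<otimes>\<^bsub>BijGroup UNIV\<^esub> g = f \<circ> g"
      using eng by (auto simp: BijGroup_def Bij_def compose_def)
    thus ?case using eng assms(5) bij_comp by metis
  qed
  thus ?thesis ..
qed

text \<open>
  Any type of \<open>a\<close> is allowed here rather than \<open>ty UNIV a\<close>, since the choice \<open>ty\<close> need not be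
  invariant under automorphisms.
\<close>

definition good_axis :: "'a set \<Rightarrow> 'a \<Rightarrow> bool" where
  "good_axis S a \<longleftrightarrow> (\<exists>l d \<tau>. axis_of_type UNIV l d a \<and> is_miyamoto l d a \<tau> \<and> \<tau> ` S \<subseteq> S)"

text \<open>Left multiplication by a generator stays in the group, so the involutions of
  \<open>X\<close> preserve the closure. For \<open>a = \<rho> y\<close> the involution of
  \<open>y\<close> is conjugated by one generator at a time along \<open>\<rho>\<close>.\<close>

lemma axis_closure_good:
  assumes ty: "type_choice ty" and X: "\<forall>x\<in>X. primitive_axis UNIV x"
  shows "X \<subseteq> axis_closure ty X" and "a \<in> axis_closure ty X \<Longrightarrow> good_axis (axis_closure ty X) a"
proof -
  let ?S = "axis_closure ty X"
  have mi: "\<exists>l d. axis_of_type UNIV l d x \<and> is_miyamoto l d x (miyamoto ty x)" if "x \<in> X" for x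
    using miyamoto_eq[OF ty] X that by metis
  have bij: "bij (miyamoto ty x) \<and> (\<forall>v. miyamoto ty x (miyamoto ty x v) = v)" if "x \<in> X" for x
    using mi[OF that] is_miyamoto_involution is_miyamoto_automorphism
    by (metis algebra_automorphism_def)
  hence bij': "\<forall>x\<in>X. bij (miyamoto ty x) \<and> (\<forall>v. miyamoto ty x (miyamoto ty x v) = v)" by blast
  have in_Bij: "miyamoto ty ` X \<subseteq> carrier (BijGroup UNIV)"
    using bij by (auto simp: BijGroup_def Bij_def)
  interpret BG: group "BijGroup (UNIV :: 'a set)" by (rule group_BijGroup)
  have one: "\<one>\<^bsub>BijGroup UNIV\<^esub> = (id :: 'a \<Rightarrow> 'a)"
    by (auto simp: BijGroup_def)
  have "x \<in> ?S" if "x \<in> X" for x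
  proof -
    have "id \<in> miyamoto_group ty X"
      unfolding miyamoto_group_def using generate.one[of "BijGroup UNIV"] by (metis one)
    thus ?thesis using that unfolding axis_closure_def by (metis (mono_tags, lifting) id_apply mem_Collect_eq)
  qed
  thus XS: "X \<subseteq> ?S" ..
  have \<tau>S: "miyamoto ty x c \<in> ?S" if x: "x \<in> X" and c: "c \<in> ?S" for x c
  proof -
    obtain \<rho> y where y: "c = \<rho> y" "y \<in> X" "\<rho> \<in> miyamoto_group ty X"
      using c by (auto simp: axis_closure_def)
    have "\<rho> \<in> carrier (BijGroup UNIV)"
      using y(3) BG.generate_incl[OF in_Bij] by (auto simp: miyamoto_group_def)
    hence "miyamoto ty x \<otimes>\<^bsub>BijGroup UNIV\<^esub> \<rho> = miyamoto ty x \<circ> \<rho>"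
      using in_Bij x by (auto simp: BijGroup_def compose_def)
    hence "miyamoto ty x \<circ> \<rho> \<in> miyamoto_group ty X"
      using generate.eng[OF generate.incl y(3)[unfolded miyamoto_group_def]] x
      by (metis image_eqI miyamoto_group_def)
    hence "(miyamoto ty x \<circ> \<rho>) y \<in> ?S" using y(2) unfolding axis_closure_def by blast
    thus ?thesis by (simp add: y(1))
  qed
  have good_X: "good_axis ?S x" if "x \<in> X" for x
    using mi[OF that] \<tau>S[OF that] unfolding good_axis_def by blast
  assume "a \<in> ?S"
  then obtain \<rho> y where y: "a = \<rho> y" "y \<in> X" "\<rho> \<in> miyamoto_group ty X"
    by (auto simp: axis_closure_def)
  \<comment> \<open>Quantifying over all good axes makes the property closed under
    composition.\<close>
  have "\<forall>b. good_axis ?S b \<longrightarrow> good_axis ?S (\<rho> b)"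
    using bij' y(3)
  proof (induction rule: miyamoto_group_induct)
    case id
    show ?case by simp
  next
    case (generator x)
    let ?\<sigma> = "miyamoto ty x"
    have \<sigma>: "algebra_automorphism ?\<sigma>"
      using mi[OF generator] is_miyamoto_automorphism by blast
    show ?case
    proof (intro allI impI)
      fix b assume "good_axis ?S b"
      then obtain l d \<tau> where \<tau>: "axis_of_type UNIV l d b" "is_miyamoto l d b \<tau>" "\<tau> ` ?S \<subseteq> ?S"
        unfolding good_axis_def by blast
      have "(?\<sigma> \<circ> \<tau> \<circ> ?\<sigma>) ` ?S \<subseteq> ?S" using \<tau>S[OF generator] \<tau>(3) by auto
      thus "good_axis ?S (?\<sigma> b)"
        using automorphism_axis[OF \<sigma> \<tau>(1)] is_miyamoto_conj[OF \<sigma> _ \<tau>(2)] bij[OF generator]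
        unfolding good_axis_def by blast
    qed
  next
    case (comp f g)
    thus ?case by simp
  qed
  thus "good_axis ?S a" using good_X y by simp
qed

text \<open>By linearity in the left factor it suffices to multiply by an axis \<open>a\<close> of
  \<open>S\<close>. Its involution preserves \<open>span S\<close>, so the odd component
  \<open>w\<close> of \<open>v\<close> lies there, and \<open>a \<star> v\<close> combines
  \<open>a\<close> and \<open>w\<close>.\<close>

lemma span_good_axes_subalgebra:
  assumes two: "(2::'f) \<noteq> 0" and good: "\<And>a. a \<in> S \<Longrightarrow> good_axis S a"
  shows "subalgebra (span S)"
proof -
  have key: "a \<star> v \<in> span S" if a: "a \<in> S" and v: "v \<in> span S" for a v
  proof -
    obtain l d \<tau> where \<tau>: "axis_of_type UNIV l d a" "is_miyamoto l d a \<tau>" "\<tau> ` S \<subseteq> S"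
      using good[OF a] unfolding good_axis_def by blast
    have \<tau>v: "\<tau> v \<in> span S" using v
    proof (induction rule: span_induct_alt)
      case base
      show ?case by (simp add: automorphismD(5)[OF is_miyamoto_automorphism[OF \<tau>(2)]] span_zero)
    next
      case (step c x y)
      thus ?case using \<tau>(3)
        by (auto simp: automorphismD[OF is_miyamoto_automorphism[OF \<tau>(2)]]
            intro!: span_add span_scale intro: span_base)
    qed
    obtain k z w where d: "v = k *s a + z + w" "z \<in> zero_part UNIV a" "w \<in> odd_part UNIV l d a"
      using axis_decomp[OF \<tau>(1) UNIV_I] .
    have "v - \<tau> v = w + w"
      using is_miyamoto_even_odd[OF \<tau>(2) even_partI[OF d(2)] d(3), of k] by (simp add: d(1))
    also have "\<dots> = 2 *s w" using scale_left_distrib[of 1 1 w] by simp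
    finally have "w = (1 / 2) *s (v - \<tau> v)" using two by simp
    hence w: "w \<in> span S" using v \<tau>v by (simp add: span_diff span_scale)
    have "a \<star> v = k *s a + l *s w"
      using d(2,3) by (simp add: d(1) alg_simps axis_idem[OF \<tau>(1)] zero_partD odd_partD)
    thus ?thesis using w a by (simp add: span_add span_scale span_base)
  qed
  have "u \<star> v \<in> span S" if "u \<in> span S" "v \<in> span S" for u v
    using that(1)
  proof (induction rule: span_induct_alt)
    case base
    show ?case by (simp add: span_zero)
  next
    case (step c x y)
    thus ?case using key[OF _ that(2)] by (simp add: alg_simps span_add span_scale)
  qed
  thus ?thesis by (simp add: subalgebra_def)
qed


subsection \<open>Pairs of axes\<close>

lemma axis_mult_decomp:
  assumes "axis_of_type B l d a" "z \<in> zero_part B a" "w \<in> odd_part B l d a" "v = k *s a + z + w"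
  shows "a \<star> v = k *s a + l *s w" "v \<star> a = k *s a + d *s w"
  using assms by (simp_all add: alg_simps axis_idem zero_partD odd_partD)

lemma axis_combination_unique:
  assumes ax: "axis_of_type UNIV l d a"
    and "z \<in> zero_part UNIV a" "w \<in> odd_part UNIV l d a"
    and "z' \<in> zero_part UNIV a" "w' \<in> odd_part UNIV l d a"
    and "k *s a + b *s z + c *s w = k' *s a + b' *s z' + c' *s w'"
  shows "k = k'" "b *s z = b' *s z'" "c *s w = c' *s w'"
  using axis_coeffs_unique[OF ax subspace_scale[OF subspace_zero_part assms(2)]
      subspace_scale[OF subspace_odd_part assms(3)] subspace_scale[OF subspace_zero_part assms(4)]
      subspace_scale[OF subspace_odd_part assms(5)] assms(6)] by simp_all

text \<open>Here \<open>y \<star> x = k *s x\<close>. If \<open>k\<close> is nonzero, decomposing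
  \<open>x\<close> with respect to \<open>y\<close> leaves either an odd idempotent, which is zero,
  or a multiple of \<open>y\<close>, which is \<open>y\<close> itself. Hence distinct nonorthogonal
  axes have nonzero odd components with respect to each other.\<close>

lemma axis_even_neighbour:
  assumes x: "axis_of_type UNIV l d x" and y: "axis_of_type UNIV l' d' y"
    and yx: "y = k *s x + z" "z \<in> zero_part UNIV x"
  shows "x \<star> y = 0 \<or> x = y"
proof (rule ccontr)
  assume contra: "\<not> ?thesis"
  have l': "l' \<noteq> 1" using axis_type_ne[OF y] by auto
  have "x \<star> y = k *s x" "y \<star> x = k *s x"
    using axis_mult_decomp[OF x yx(2) subspace_0[OF subspace_odd_part], of y k] yx(1) by simp_all
  hence k: "k \<noteq> 0" "y \<star> x = k *s x" using contra by auto
  obtain b z' w' where d: "x = b *s y + z' + w'" "z' \<in> zero_part UNIV y" "w' \<in> odd_part UNIV l' d' y"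
    using axis_decomp[OF y UNIV_I] .
  have "b *s y + 0 *s z' + l' *s w' = (k * b) *s y + k *s z' + k *s w'"
    using axis_mult_decomp(1)[OF y d(2,3,1)] k(2) d(1) by (simp add: alg_simps)
  note * = axis_combination_unique[OF y d(2,3,2,3) this]
  have z': "z' = 0" using * k by simp
  show False
  proof (cases "b = 0")
    case True
    hence "x = w'" using d(1) z' by simp
    hence "x = 0" using odd_idem_eq_0[OF y] d(3) axis_idem[OF x] by simp
    thus False using axis_nonzero[OF x] by simp
  next
    case False
    hence "k = 1" using * by simp
    hence "(l' - 1) *s w' = 0" using * by (simp add: scale_left_diff_distrib)
    hence "w' = 0" using l' by simp
    hence xy: "x = b *s y" using d(1) z' by simp
    have "b * b = b"
    proof -
      have "x \<star> x = (b * b) *s y" by (simp add: xy alg_simps axis_idem[OF y])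
      hence "(b * b) *s y = b *s y" using axis_idem[OF x] xy by simp
      thus ?thesis using axis_nonzero[OF y] scale_right_imp_eq by blast
    qed
    hence "b = 1" using False by simp
    thus False using xy contra by simp
  qed
qed

lemma mult_eq_0_imp_zero_part:
  assumes x: "axis_of_type UNIV l d x" and "x \<star> y = 0"
  shows "y \<in> zero_part UNIV x"
proof -
  obtain k z w where d: "y = k *s x + z + w" "z \<in> zero_part UNIV x" "w \<in> odd_part UNIV l d x"
    using axis_decomp[OF x UNIV_I] .
  have "k *s x + 0 + l *s w = 0"
    using axis_mult_decomp(1)[OF x d(2,3,1)] assms(2) by simp
  hence "k = 0 \<and> l *s w = 0"
    using axis_independent[OF axis_nonzero[OF x] axis_idem[OF x]] axis_type_ne[OF x] d(3)
    by (metis mult_scale_right mult_zero_right odd_partD(1))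
  thus ?thesis using d axis_type_ne[OF x] by simp
qed

section \<open>Adjacent axes of noncommutative type\<close>

text \<open>Since \<open>w \<star> w\<close> is even, the odd parts of the eigenvector equations
  give \<open>z \<star> w = k *s w\<close> and \<open>w \<star> z = m *s w\<close>. The odd part of
  \<open>y \<star> y = y\<close> is \<open>z \<star> w + w \<star> z = w\<close>.\<close>

lemma odd_part_eigenvalues_sum:
  assumes x: "axis_of_type UNIV l d x"
    and y: "y \<star> y = y" "y = z + w" "z \<in> zero_part UNIV x" "w \<in> odd_part UNIV l d x"
    and e: "y \<star> w = k *s w" "w \<star> y = m *s w" and w0: "w \<noteq> 0"
  shows "k + m = 1"
proof -
  note fus = axis_fusion[OF x]
  have ze: "z \<in> even_part UNIV x" using y(3) by (rule zero_part_even)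
  have eq: "w \<star> w + z \<star> w = 0 + k *s w" "w \<star> w + w \<star> z = 0 + m *s w"
    using e unfolding y(2) by (simp_all add: mult_add_left mult_add_right add.commute)
  note fus_zw = fus(4)[OF y(4,4)] fus(2)[OF ze y(4)] fus(3)[OF y(4) ze] fus(1)[OF ze ze]
    subspace_0[OF subspace_even_part] subspace_scale[OF subspace_odd_part y(4)]
  have zw: "z \<star> w = k *s w" "w \<star> z = m *s w"
    using even_odd_unique[OF x fus_zw(1,2,5,6) eq(1)] even_odd_unique[OF x fus_zw(1,3,5,6) eq(2)] by simp_all
  have "(z \<star> z + w \<star> w) + (z \<star> w + w \<star> z) = z + w"
    using y(1) unfolding y(2) by (simp add: mult_add_left mult_add_right add_ac)
  from even_odd_unique[OF x _ _ ze y(4) this]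
  have "z \<star> w + w \<star> z = w"
    using fus_zw subspace_add[OF subspace_even_part] subspace_add[OF subspace_odd_part] by simp
  hence "(k + m) *s w = 1 *s w" using zw by (simp add: scale_left_distrib)
  thus ?thesis using w0 scale_right_imp_eq by blast
qed

text \<open>The commutator \<open>e\<close> of \<open>x\<close> and \<open>y\<close> is a nonzero
  multiple of both odd components, hence odd with respect to both axes. Everything is then compared
  through \<open>e\<close>.\<close>

lemma noncommutative_neighbour:
  assumes x: "axis_of_type UNIV l d x" and y: "axis_of_type UNIV l' d' y"
    and xy: "x \<star> y \<noteq> 0" "x \<noteq> y" and ld: "l \<noteq> d"
  shows "(l', d') = (l, d) \<or> (l', d') = (d, l)"
proof -
  obtain \<alpha> z w where dy: "y = \<alpha> *s x + z + w" "z \<in> zero_part UNIV x" "w \<in> odd_part UNIV l d x"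
    using axis_decomp[OF x UNIV_I] .
  obtain \<beta> u v where dx: "x = \<beta> *s y + u + v" "u \<in> zero_part UNIV y" "v \<in> odd_part UNIV l' d' y"
    using axis_decomp[OF y UNIV_I] .
  have w0: "w \<noteq> 0" using axis_even_neighbour[OF x y _ dy(2), of \<alpha>] dy(1) xy by auto
  note px = axis_mult_decomp[OF x dy(2,3,1)] and py = axis_mult_decomp[OF y dx(2,3,1)]
  define e where "e = x \<star> y - y \<star> x"
  have e1: "e = (l - d) *s w" by (simp add: e_def px scale_left_diff_distrib)
  \<comment> \<open>The signs are opposite to those in \<open>e1\<close>, because \<open>x\<close>,
    the element being decomposed, is now the left factor of \<open>x \<star> y\<close>.\<close>
  have e2: "e = (d' - l') *s v" by (simp add: e_def py scale_left_diff_distrib)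
  have e0: "e \<noteq> 0" using e1 w0 ld by simp
  have ld': "d' \<noteq> l'" using e2 e0 by auto
  have ex: "e \<in> odd_part UNIV l d x" using e1 dy(3) subspace_scale[OF subspace_odd_part] by blast
  have ey: "e \<in> odd_part UNIV l' d' y" using e2 dx(3) subspace_scale[OF subspace_odd_part] by blast
  define r where "r = 1 / (l - d)"
  define s where "s = 1 / (d' - l')"
  have rs: "r * (l - d) = 1" "s * (d' - l') = 1" using ld ld' by (simp_all add: r_def s_def)
  have w: "w = r *s e" unfolding e1 by (simp only: scale_scale rs scale_one)
  have v: "v = s *s e" unfolding e2 by (simp only: scale_scale rs scale_one)
  note E = odd_partD[OF ex] odd_partD[OF ey]
  define c where "c = l * r - d' * s"
  have rel: "\<alpha> *s x + c *s e = \<beta> *s y"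
    using px(1) py(2) by (simp add: c_def w v scale_left_diff_distrib algebra_simps)
  show ?thesis
  proof (cases "\<alpha> = 0")
    \<comment> \<open>Neither axis has a component along the other, so each type sums to 1; the
      vanishing of \<open>c\<close> gives \<open>l * l' = d * d'\<close>, and together these force
      the swapped type.\<close>
    case True
    hence "\<beta> *s y + 0 *s u + 0 *s e = 0 *s y + 0 *s u + c *s e" using rel by simp
    note uniq = axis_combination_unique[OF y dx(2) ey dx(2) ey this]
    have \<beta>: "\<beta> = 0" by (rule uniq(1))
    have c: "c = 0" using uniq(3) e0 by simp
    have v0: "v \<noteq> 0" using e2 e0 by auto
    have "l' + d' = 1"
      by (rule odd_part_eigenvalues_sum[OF x axis_idem[OF y] _ dy(2,3) _ _ w0])
        (use dy(1) True in simp, simp_all add: w mult_scale_left mult_scale_right E mult.commute)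
    moreover have "l + d = 1"
      by (rule odd_part_eigenvalues_sum[OF y axis_idem[OF x] _ dx(2,3) _ _ v0])
        (use dx(1) \<beta> in simp, simp_all add: v mult_scale_left mult_scale_right E mult.commute)
    moreover have "l * l' = d * d'"
    proof -
      have "(l * r - d' * s) * (l - d) * (d' - l') = l * (d' - l') - d' * (l - d)"
        using rs by algebra
      hence "l * (d' - l') - d' * (l - d) = 0" using c by (simp add: c_def)
      thus ?thesis by algebra
    qed
    ultimately have "l' = d \<and> d' = l" by algebra
    thus ?thesis by simp
  next
    \<comment> \<open>Now \<open>y = x + r *s e\<close>, so \<open>y \<star> e\<close> and
      \<open>x \<star> e\<close> differ by the even element \<open>r *s (e \<star> e)\<close>; their
      odd parts give equal left eigenvalues, and likewise on the right.\<close>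
    case False
    have "(\<beta> * \<alpha>) *s x + \<beta> *s z + \<beta> *s w = \<alpha> *s x + 0 *s z + c *s e"
      using rel by (simp add: dy(1) scale_right_distrib)
    note uniq = axis_combination_unique[OF x dy(2,3) dy(2) ex this]
    have \<beta>: "\<beta> = 1" using uniq(1) False by simp
    have z: "z = 0" using uniq(2) \<beta> by simp
    have "\<beta> *s y + 0 *s u + 0 *s e = (\<alpha> * \<beta>) *s y + \<alpha> *s u + (\<alpha> * s + c) *s e"
    proof -
      have "\<beta> *s y = \<alpha> *s (\<beta> *s y + u + s *s e) + c *s e" using rel dx(1) v by simp
      thus ?thesis by (simp add: scale_right_distrib scale_left_distrib)
    qed
    from axis_combination_unique(1)[OF y dx(2) ey dx(2) ey this]
    have "\<alpha> = 1" using \<beta> by simp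
    hence yx: "y = x + r *s e" using dy(1) z w by simp
    have "(r *s (e \<star> e)) + l *s e = 0 + l' *s e" "(r *s (e \<star> e)) + d *s e = 0 + d' *s e"
      using E(3,4) by (simp_all add: yx alg_simps E(1,2) add.commute)
    moreover have "r *s (e \<star> e) \<in> even_part UNIV x" "0 \<in> even_part UNIV x"
      "k *s e \<in> odd_part UNIV l d x" for k
      by (intro axis_fusion(4)[OF x ex ex] ex subspace_scale[OF subspace_even_part]
        subspace_0[OF subspace_even_part] subspace_scale[OF subspace_odd_part])+
    ultimately have "l *s e = l' *s e" "d *s e = d' *s e"
      using even_odd_unique[OF x, of "r *s (e \<star> e)" _ 0] by blast+
    thus ?thesis using e0 by simp
  qed
qed

section \<open>Adjacent axes of commutative types\<close>

text \<open>Both claims come from \<open>l *s (y \<star> w)\<close>, computed once through the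
  action of \<open>y\<close> on \<open>p = x \<star> y\<close> and once through the decomposition of
  \<open>y\<close>: its odd part with respect to \<open>x\<close> gives the first, its even part the
  second. The lemma is also used with \<open>x\<close> and \<open>y\<close> exchanged.\<close>

lemma commutative_pair:
  assumes x: "axis_of_type UNIV l l x" and y: "axis_of_type UNIV m m y"
    and dy: "y = \<alpha> *s x + z + w" "z \<in> zero_part UNIV x" "w \<in> odd_part UNIV l l x"
    and dx: "x = \<beta> *s y + u + v" "u \<in> zero_part UNIV y" "v \<in> odd_part UNIV m m y"
    and w0: "w \<noteq> 0"
  shows "l = 2 * ((m - \<alpha>) * l + \<beta> * (1 - m))"
    and "l *s (w \<star> w) = ((m - \<alpha>) * \<alpha>) *s x + (\<beta> * (1 - m)) *s (\<alpha> *s x + z)"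
proof -
  note px = axis_mult_decomp[OF x dy(2,3,1)] and py = axis_mult_decomp[OF y dx(2,3,1)]
  note xw = odd_partD[OF dy(3)] and yv = odd_partD[OF dx(3)]
  note fus = axis_fusion[OF x]
  define p where "p = x \<star> y"
  have p1: "p = \<alpha> *s x + l *s w" and p1': "y \<star> x = p" by (simp_all add: p_def px)
  have p2: "p = \<beta> *s y + m *s v" by (simp add: p_def py)
  have yp: "y \<star> p = m *s p + (\<beta> * (1 - m)) *s y"
    by (simp add: p2 alg_simps axis_idem[OF y] yv scale_left_diff_distrib right_diff_distrib mult.commute)
  have py': "p \<star> y = m *s p + (\<beta> * (1 - m)) *s y"
    by (simp add: p2 alg_simps axis_idem[OF y] yv scale_left_diff_distrib right_diff_distrib mult.commute)
  have lw: "l *s w = p - \<alpha> *s x" by (simp add: p1)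
  have l0: "l \<noteq> 0" using axis_type_ne[OF x] by simp
  have yw: "l *s (y \<star> w) = (m - \<alpha>) *s p + (\<beta> * (1 - m)) *s y"
  proof -
    have "l *s (y \<star> w) = y \<star> (l *s w)" by (simp add: mult_scale_right)
    also have "\<dots> = y \<star> p - \<alpha> *s p" unfolding lw by (simp add: mult_diff_right mult_scale_right p1')
    finally show ?thesis by (simp add: yp scale_left_diff_distrib)
  qed
  have wy: "l *s (w \<star> y) = (m - \<alpha>) *s p + (\<beta> * (1 - m)) *s y"
  proof -
    have "l *s (w \<star> y) = (l *s w) \<star> y" by (simp add: mult_scale_left)
    also have "\<dots> = p \<star> y - \<alpha> *s p" unfolding lw by (simp add: mult_diff_left mult_scale_left p_def)
    finally show ?thesis by (simp add: py' scale_left_diff_distrib)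
  qed
  have "l *s (y \<star> w) = l *s (w \<star> y)" by (simp add: yw wy)
  hence "y \<star> w = w \<star> y" using l0 scale_left_imp_eq by blast
  hence zw: "w \<star> z = z \<star> w" by (simp add: dy(1) alg_simps xw)
  have parts: "\<alpha> *s x + z \<in> even_part UNIV x" "z \<in> even_part UNIV x" "x \<in> even_part UNIV x"
    using dy(2) even_partI zero_part_even axis_even by auto
  note subE = subspace_add[OF subspace_even_part] subspace_scale[OF subspace_even_part]
  note subO = subspace_add[OF subspace_odd_part] subspace_scale[OF subspace_odd_part]
  \<comment> \<open>This is \<open>y \<star> y = y\<close> sorted by parity; its odd part determines
    \<open>2 *s (z \<star> w)\<close>.\<close>
  have "((\<alpha> *s x + z) \<star> (\<alpha> *s x + z) + w \<star> w) + ((2 * \<alpha> * l) *s w + 2 *s (z \<star> w)) = (\<alpha> *s x + z) + w"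
  proof -
    have two_scale: "2 *s t = t + t" for t using scale_left_distrib[of 1 1 t] by simp
    have "((\<alpha> *s x + z) + w) \<star> ((\<alpha> *s x + z) + w) = (\<alpha> *s x + z) + w"
      using axis_idem[OF y] by (simp only: dy(1))
    thus ?thesis
      by (simp add: mult_add_left[of _ w] mult_add_right[of _ _ w])
        (simp add: alg_simps xw zw two_scale mult.assoc add_ac flip: scale_scale)
  qed
  hence "(2 * \<alpha> * l) *s w + 2 *s (z \<star> w) = w"
    using even_odd_unique[OF x, of "(\<alpha> *s x + z) \<star> (\<alpha> *s x + z) + w \<star> w" "(2 * \<alpha> * l) *s w + 2 *s (z \<star> w)"
      "\<alpha> *s x + z" w] by (simp add: subE subO fus parts dy(3))
  hence zw2: "2 *s (z \<star> w) = (1 - 2 * \<alpha> * l) *s w"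
    by (simp add: scale_left_diff_distrib algebra_simps)
  have "l *s (w \<star> w) + ((l * \<alpha> * l) *s w + l *s (z \<star> w))
      = (((m - \<alpha>) * \<alpha>) *s x + (\<beta> * (1 - m)) *s (\<alpha> *s x + z)) + ((m - \<alpha>) * l + \<beta> * (1 - m)) *s w"
  proof -
    have "l *s (w \<star> w) + ((l * \<alpha> * l) *s w + l *s (z \<star> w)) = l *s (y \<star> w)"
      by (simp add: dy(1) alg_simps xw add_ac mult.assoc)
    also have "\<dots> = (m - \<alpha>) *s (\<alpha> *s x + l *s w) + (\<beta> * (1 - m)) *s (\<alpha> *s x + z + w)"
      unfolding yw using p1 dy(1) by simp
    finally show ?thesis by (simp add: scale_right_distrib scale_left_distrib add_ac)
  qed
  hence *: "l *s (w \<star> w) = ((m - \<alpha>) * \<alpha>) *s x + (\<beta> * (1 - m)) *s (\<alpha> *s x + z)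
      \<and> (l * \<alpha> * l) *s w + l *s (z \<star> w) = ((m - \<alpha>) * l + \<beta> * (1 - m)) *s w"
    by (intro even_odd_unique[OF x] subE subO fus parts dy(3))
  thus "l *s (w \<star> w) = ((m - \<alpha>) * \<alpha>) *s x + (\<beta> * (1 - m)) *s (\<alpha> *s x + z)" ..
  have "2 *s ((l * \<alpha> * l) *s w + l *s (z \<star> w)) = (2 * (l * \<alpha> * l)) *s w + l *s (2 *s (z \<star> w))"
    by (simp add: scale_right_distrib mult.commute)
  also have "\<dots> = (2 * (l * \<alpha> * l) + l * (1 - 2 * \<alpha> * l)) *s w"
    by (simp add: zw2 scale_left_distrib)
  also have "2 * (l * \<alpha> * l) + l * (1 - 2 * \<alpha> * l) = l" by (simp add: algebra_simps)
  finally have "l *s w = (2 * ((m - \<alpha>) * l + \<beta> * (1 - m))) *s w"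
    unfolding conjunct2[OF *] by (simp only: scale_scale)
  thus "l = 2 * ((m - \<alpha>) * l + \<beta> * (1 - m))" using w0 scale_right_imp_eq by blast
qed

text \<open>The first identity of \<open>commutative_pair\<close>, used in both directions, gives
  two linear relations between \<alpha> and \<beta>. They suffice for equal types; distinct types
  need the third relation \<open>E3\<close>.\<close>

lemma commutative_neighbour:
  assumes x: "axis_of_type UNIV l l x" and y: "axis_of_type UNIV m m y"
    and xy: "x \<star> y \<noteq> 0" "x \<noteq> y"
    and dy: "y = \<alpha> *s x + z + w" "z \<in> zero_part UNIV x" "w \<in> odd_part UNIV l l x"
    and dx: "x = \<beta> *s y + u + v" "u \<in> zero_part UNIV y" "v \<in> odd_part UNIV m m y"
  shows "l \<noteq> m \<Longrightarrow> l + m = 1 \<and> 2 * \<alpha> = 1 + m \<and> 2 * \<beta> = 1 + l"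
    and "l = m \<Longrightarrow> 2 * l \<noteq> 1 \<Longrightarrow> 2 * \<alpha> = l"
proof -
  note px = axis_mult_decomp[OF x dy(2,3,1)] and py = axis_mult_decomp[OF y dx(2,3,1)]
  have yx0: "y \<star> x \<noteq> 0" using px xy(1) by simp
  have w0: "w \<noteq> 0" using axis_even_neighbour[OF x y _ dy(2), of \<alpha>] dy(1) xy by auto
  have v0: "v \<noteq> 0" using axis_even_neighbour[OF y x _ dx(2), of \<beta>] dx(1) xy yx0 by auto
  note c1 = commutative_pair[OF x y dy dx w0] and c2 = commutative_pair[OF y x dx dy v0]
  have l: "l \<noteq> 0" "m \<noteq> 0" using axis_type_ne[OF x] axis_type_ne[OF y] by auto
  show "2 * \<alpha> = l" if "l = m" "2 * l \<noteq> 1"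
  proof -
    have "(1 - 2 * l) * (2 * \<alpha> - l) = 0"
      using c1(1) c2(1) unfolding that(1)[symmetric] by algebra
    thus ?thesis using that(2) by simp
  qed
  assume lm: "l \<noteq> m"
  have mv: "m *s v = \<alpha> *s x + l *s w - \<beta> *s y" using px(1) py(2) by (simp add: algebra_simps)
  have xx: "x \<star> x = x" by (rule axis_idem[OF x])
  have yy: "y \<star> y = y" by (rule axis_idem[OF y])
  have two_scale: "2 *s t = t + t" for t using scale_left_distrib[of 1 1 t] by simp
  \<comment> \<open>The missing relation between \<open>\<alpha>\<close> and \<open>\<beta>\<close> comes from computing \<open>(x y)(x y)\<close> with respect to
    \<open>x\<close> and with respect to \<open>y\<close>.\<close>
  have pp1: "(x \<star> y) \<star> (x \<star> y) = (\<alpha> * \<alpha> + l * (m - \<alpha>) * \<alpha> + l * \<beta> * (1 - m) * \<alpha>) *s x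
      + (l * \<beta> * (1 - m)) *s z + (2 * \<alpha> * l * l) *s w"
  proof -
    have "(x \<star> y) \<star> (x \<star> y) = (\<alpha> * \<alpha>) *s x + (2 * \<alpha> * l * l) *s w + l *s (l *s (w \<star> w))"
      unfolding px(1) by (simp add: alg_simps xx odd_partD[OF dy(3)] two_scale add_ac mult.assoc scale_left_commute flip: scale_scale)
    thus ?thesis unfolding c1(2) by (simp add: scale_right_distrib scale_left_distrib add_ac mult.assoc)
  qed
  have pp2: "(x \<star> y) \<star> (x \<star> y) = (\<beta> * \<beta> + m * (l - \<beta>) * \<beta> + m * \<alpha> * (1 - l) * \<beta>) *s y
      + (m * \<alpha> * (1 - l)) *s u + (2 * \<beta> * m * m) *s v"
  proof -
    have "(x \<star> y) \<star> (x \<star> y) = (\<beta> * \<beta>) *s y + (2 * \<beta> * m * m) *s v + m *s (m *s (v \<star> v))"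
      unfolding py(2) by (simp add: alg_simps yy odd_partD[OF dx(3)] two_scale add_ac mult.assoc scale_left_commute flip: scale_scale)
    thus ?thesis unfolding c2(2) by (simp add: scale_right_distrib scale_left_distrib add_ac mult.assoc)
  qed
  have collect: "A *s y + (C *s (x - \<beta> *s y) + D *s (\<alpha> *s x + l *s w - \<beta> *s y))
      = (A - C * \<beta> - D * \<beta>) *s y + ((C + D * \<alpha>) *s x + (D * l) *s w)" for A C D
    by (simp add: scale_right_distrib scale_left_distrib scale_left_diff_distrib scale_right_diff_distrib algebra_simps)
  \<comment> \<open>This is the coefficient of \<open>y\<close> once \<open>u\<close> and
    \<open>v\<close> are eliminated from \<open>pp2\<close> by means of \<open>dx\<close> and
    \<open>mv\<close>. As \<open>z\<close> then enters only through \<open>y\<close>, it is also the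
    coefficient of \<open>z\<close>.\<close>
  define Q where "Q = \<beta> * (\<beta> + m * l - 3 * m * \<beta> + \<alpha> * (1 - l))"
  have "(\<beta> * \<beta> + m * (l - \<beta>) * \<beta> + m * \<alpha> * (1 - l) * \<beta>) *s y
      + (m * \<alpha> * (1 - l)) *s u + (2 * \<beta> * m * m) *s v
     = Q *s y + (2 * \<alpha> * \<beta> * m + \<alpha> * (1 - l) * (m - \<alpha>)) *s x + (2 * \<beta> * m * l - \<alpha> * l * (1 - l)) *s w"
  proof -
    have u: "u = x - \<beta> *s y - v" using dx(1) by simp
    have "(m * \<alpha> * (1 - l)) *s u + (2 * \<beta> * m * m) *s v
      = (m * \<alpha> * (1 - l)) *s (x - \<beta> *s y) + (2 * \<beta> * m - \<alpha> * (1 - l)) *s (m *s v)"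
      unfolding u by (simp add: scale_right_diff_distrib scale_left_diff_distrib algebra_simps)
    hence "(\<beta> * \<beta> + m * (l - \<beta>) * \<beta> + m * \<alpha> * (1 - l) * \<beta>) *s y
        + (m * \<alpha> * (1 - l)) *s u + (2 * \<beta> * m * m) *s v
      = (\<beta> * \<beta> + m * (l - \<beta>) * \<beta> + m * \<alpha> * (1 - l) * \<beta> - m * \<alpha> * (1 - l) * \<beta>
          - (2 * \<beta> * m - \<alpha> * (1 - l)) * \<beta>) *s y
        + (m * \<alpha> * (1 - l) + (2 * \<beta> * m - \<alpha> * (1 - l)) * \<alpha>) *s x
        + ((2 * \<beta> * m - \<alpha> * (1 - l)) * l) *s w"
      unfolding mv by (simp only: add.assoc collect)
    moreover have "\<beta> * \<beta> + m * (l - \<beta>) * \<beta> + m * \<alpha> * (1 - l) * \<beta> - m * \<alpha> * (1 - l) * \<beta>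
          - (2 * \<beta> * m - \<alpha> * (1 - l)) * \<beta> = Q"
      unfolding Q_def by algebra
    moreover have "m * \<alpha> * (1 - l) + (2 * \<beta> * m - \<alpha> * (1 - l)) * \<alpha> = 2 * \<alpha> * \<beta> * m + \<alpha> * (1 - l) * (m - \<alpha>)"
      by algebra
    moreover have "(2 * \<beta> * m - \<alpha> * (1 - l)) * l = 2 * \<beta> * m * l - \<alpha> * l * (1 - l)"
      by algebra
    ultimately show ?thesis by simp
  qed
  also have "\<dots> = (Q * \<alpha> + (2 * \<alpha> * \<beta> * m + \<alpha> * (1 - l) * (m - \<alpha>))) *s x
     + Q *s z + (Q + (2 * \<beta> * m * l - \<alpha> * l * (1 - l))) *s w"
    by (subst dy(1)) (simp only: scale_right_distrib scale_left_distrib scale_scale add_ac)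
  finally have pp3: "(x \<star> y) \<star> (x \<star> y) = (Q * \<alpha> + (2 * \<alpha> * \<beta> * m + \<alpha> * (1 - l) * (m - \<alpha>))) *s x
     + Q *s z + (Q + (2 * \<beta> * m * l - \<alpha> * l * (1 - l))) *s w"
    unfolding pp2 .
  note uniq = axis_combination_unique[OF x dy(2,3,2,3) pp1[symmetric, THEN trans, OF pp3]]
  have *: "l * \<beta> * (1 - m) = Q \<or> z = 0" "2 * \<alpha> * l * l = Q + (2 * \<beta> * m * l - \<alpha> * l * (1 - l))"
    using scale_right_imp_eq[OF _ uniq(2)] scale_right_imp_eq[OF w0 uniq(3)] by blast+
  \<comment> \<open>If \<open>z\<close> vanished, \<open>x \<star> y\<close> would be a combination
    of \<open>x\<close> and \<open>y\<close>; its components with respect to \<open>y\<close>,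
    together with the two pair relations, give \<open>1 - l = 2 * m * l = 1 - m\<close>.\<close>
  have z: "z \<noteq> 0"
  proof
    assume z: "z = 0"
    have "\<beta> *s y + 0 *s u + m *s v = (\<alpha> * (1 - l) * \<beta> + l) *s y + (\<alpha> * (1 - l)) *s u + (\<alpha> * (1 - l)) *s v"
    proof -
      have w: "w = y - \<alpha> *s x" using dy(1) z by simp
      have "\<beta> *s y + m *s v = (\<alpha> * (1 - l)) *s x + l *s y"
        using px(1) py(2) unfolding w
        by (simp add: scale_right_diff_distrib scale_left_diff_distrib algebra_simps)
      also have "\<dots> = (\<alpha> * (1 - l)) *s (\<beta> *s y + u + v) + l *s y" by (simp flip: dx(1))
      finally show ?thesis by (simp add: scale_right_distrib scale_left_distrib add_ac)
    qed
    note uniq = axis_combination_unique[OF y dx(2,3,2,3) this]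
    have 1: "m = \<alpha> * (1 - l)" by (rule scale_right_imp_eq[OF v0 uniq(3)])
    hence 1: "\<beta> = m * \<beta> + l" "m = \<alpha> * (1 - l)" using uniq(1) by auto
    have "l * (2 * m - 2 * \<alpha> + 1) = 0" using c1(1) 1(1) by algebra
    hence "2 * m - 2 * \<alpha> + 1 = 0" using l by (metis mult_eq_0_iff)
    hence 2: "2 * \<alpha> = 2 * m + 1" by algebra
    have "m * (2 * l - 2 * \<beta> + 1) = 0" using c2(1) 1(2) by algebra
    hence "2 * l - 2 * \<beta> + 1 = 0" using l by (metis mult_eq_0_iff)
    hence 3: "2 * \<beta> = 2 * l + 1" by algebra
    have "2 * m = (2 * \<alpha>) * (1 - l)" using 1(2) by simp
    hence "1 - l = 2 * m * l" unfolding 2 by (simp add: algebra_simps)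
    moreover have "2 * \<beta> = m * (2 * \<beta>) + 2 * l" by (subst 1(1)) (simp add: algebra_simps)
    hence "1 - m = 2 * m * l" unfolding 3 by (simp add: algebra_simps)
    ultimately have "1 - l = 1 - m" by simp
    hence "l = m" by simp
    thus False using lm by simp
  qed
  have "2 * \<alpha> * l * l = l * \<beta> * (1 - m) + (2 * \<beta> * m * l - \<alpha> * l * (1 - l))"
    using * z by simp
  hence "l * (\<alpha> * (l + 1) - \<beta> * (m + 1)) = 0" by algebra
  hence E3: "\<alpha> * (l + 1) = \<beta> * (m + 1)" using l by simp
  have "(l - m) * (2 * \<alpha> - (1 + m)) = 0" using c1(1) c2(1) E3 by algebra
  hence \<alpha>: "2 * \<alpha> = 1 + m" using lm by simp
  have "(l - m) * (2 * \<beta> - (1 + l)) = 0" using c1(1) c2(1) E3 by algebra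
  hence \<beta>: "2 * \<beta> = 1 + l" using lm by simp
  have "l + m = 1" using c1(1) \<alpha> \<beta> by algebra
  thus "l + m = 1 \<and> 2 * \<alpha> = 1 + m \<and> 2 * \<beta> = 1 + l" using \<alpha> \<beta> by simp
qed

section \<open>Generation and adjacency for axes of two commutative types\<close>

text \<open>Half of \<open>x - \<tau> x\<close> is the odd component \<open>v\<close> of
  \<open>x\<close>, so \<open>S\<close> contains \<open>v\<close> and the even component
  \<open>\<beta> *s y + u\<close>. The formula for \<open>v \<star> v\<close> then isolates a
  multiple of \<open>y\<close>.\<close>

lemma mixed_pair_generates:
  assumes two: "(2::'f) \<noteq> 0"
    and x: "axis_of_type UNIV l l x" and y: "axis_of_type UNIV m m y"
    and xy: "x \<star> y \<noteq> 0" and lm: "l \<noteq> m" "l \<noteq> - 1"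
    and \<tau>: "is_miyamoto m m y \<tau>" and S: "subalgebra S" "x \<in> S" "\<tau> x \<in> S"
  shows "y \<in> S"
proof (cases "x = y")
  case True
  thus ?thesis using S by simp
next
  case False
  have sub: "subspace S" and mult: "\<And>a b. a \<in> S \<Longrightarrow> b \<in> S \<Longrightarrow> a \<star> b \<in> S"
    using S(1) by (auto simp: subalgebra_def)
  obtain \<alpha> z w where dy: "y = \<alpha> *s x + z + w" "z \<in> zero_part UNIV x" "w \<in> odd_part UNIV l l x"
    using axis_decomp[OF x UNIV_I] .
  obtain \<beta> u v where dx: "x = \<beta> *s y + u + v" "u \<in> zero_part UNIV y" "v \<in> odd_part UNIV m m y"
    using axis_decomp[OF y UNIV_I] .
  have "y \<star> x \<noteq> 0" using mult_eq_0_imp_zero_part[OF y] xy zero_partD by blast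
  hence v0: "v \<noteq> 0" using axis_even_neighbour[OF y x _ dx(2), of \<beta>] dx(1) False by auto
  have coef: "2 * \<beta> = 1 + l"
    using commutative_neighbour(1)[OF x y xy False dy dx lm(1)] by simp
  have "\<tau> x = (\<beta> *s y + u) - v"
    using is_miyamoto_even_odd[OF \<tau> even_partI[OF dx(2)] dx(3), of \<beta>] by (simp flip: dx(1))
  hence "x - \<tau> x = v + v" by (subst dx(1)) simp
  hence "x - \<tau> x = 2 *s v" using scale_left_distrib[of 1 1 v] by simp
  hence "v = (1 / 2) *s (x - \<tau> x)" using two by simp
  hence v: "v \<in> S" using subspace_scale[OF sub subspace_diff[OF sub S(2,3)]] by simp
  have "\<beta> *s y + u = x - v" using dx(1) by simp
  hence e: "\<beta> *s y + u \<in> S" using subspace_diff[OF sub S(2) v] by simp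
  have "((l - \<beta>) * \<beta>) *s y = m *s (v \<star> v) - (\<alpha> * (1 - l)) *s (\<beta> *s y + u)"
    using commutative_pair(2)[OF y x dx dy v0] by simp
  hence "((l - \<beta>) * \<beta>) *s y \<in> S"
    by (simp add: subspace_diff[OF sub] subspace_scale[OF sub] mult[OF v v] e)
  hence "(1 / ((l - \<beta>) * \<beta>)) *s (((l - \<beta>) * \<beta>) *s y) \<in> S" by (rule subspace_scale[OF sub])
  \<comment> \<open>From \<open>2 * \<beta> = 1 + l\<close>, four times this coefficient equals
    \<open>(l - 1) * (l + 1)\<close>.\<close>
  moreover have "(l - \<beta>) * \<beta> \<noteq> 0"
  proof
    assume "(l - \<beta>) * \<beta> = 0"
    hence "(l - 1) * (l + 1) = 0" using coef by algebra
    hence "l = 1 \<or> l = - 1" by (simp add: eq_neg_iff_add_eq_0)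
    thus False using axis_type_ne[OF x] lm(2) by blast
  qed
  ultimately show ?thesis by simp
qed

text \<open>Otherwise \<open>y\<close> and the odd component \<open>w\<close> of \<open>y\<close>
  with respect to \<open>c\<close> are both even for \<open>x\<close>. The odd part of
  \<open>y \<star> c = \<phi> *s c + m *s w\<close> makes the odd component \<open>t\<close> of
  \<open>c\<close> an eigenvector of \<open>y\<close> for \<open>\<phi>\<close>, half of
  \<open>m\<close>. As this is neither 0 nor \<open>m\<close>, \<open>t\<close> is a multiple of
  \<open>y\<close>, hence zero, contradicting \<open>axis_even_neighbour\<close>.\<close>

lemma not_orthogonal_to_both:
  assumes two: "(2::'f) \<noteq> 0"
    and x: "axis_of_type UNIV l l x" and c: "axis_of_type UNIV m m c" and y: "axis_of_type UNIV m m y"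
    and m: "2 * m \<noteq> 1" and \<tau>: "is_miyamoto m m c \<tau>"
    and xc: "x \<star> c \<noteq> 0" "x \<noteq> c" and cy: "c \<star> y \<noteq> 0" "c \<noteq> y"
    and xy: "x \<star> y = 0"
  shows "x \<star> \<tau> y \<noteq> 0"
proof
  assume x\<tau>: "x \<star> \<tau> y = 0"
  obtain \<phi> z w where dy: "y = \<phi> *s c + z + w" "z \<in> zero_part UNIV c" "w \<in> odd_part UNIV m m c"
    using axis_decomp[OF c UNIV_I] .
  obtain \<beta> u v where dc: "c = \<beta> *s y + u + v" "u \<in> zero_part UNIV y" "v \<in> odd_part UNIV m m y"
    using axis_decomp[OF y UNIV_I] .
  have \<phi>: "2 * \<phi> = m" by (rule commutative_neighbour(2)[OF c y cy dy dc refl m])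
  have m0: "m \<noteq> 0" using axis_type_ne[OF c] by simp
  have \<phi>0: "\<phi> \<noteq> 0" using \<phi> m0 by auto
  have \<phi>m: "\<phi> \<noteq> m"
  proof
    assume "\<phi> = m"
    hence "m + m = m" using \<phi> by (metis mult_2)
    hence "m = 0" by (metis add_cancel_right_left)
    thus False using m0 by simp
  qed
  have "\<tau> y = (\<phi> *s c + z) - w"
    using is_miyamoto_even_odd[OF \<tau> even_partI[OF dy(2)] dy(3), of \<phi>] by (simp flip: dy(1))
  hence "y - \<tau> y = w + w" by (subst dy(1)) simp
  hence "y - \<tau> y = 2 *s w" using scale_left_distrib[of 1 1 w] by simp
  hence "w = (1 / 2) *s (y - \<tau> y)" using two by simp
  hence "x \<star> w = 0" by (simp add: mult_scale_right mult_diff_right xy x\<tau>)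
  hence w: "w \<in> even_part UNIV x" using mult_eq_0_imp_zero_part[OF x] zero_part_even by blast
  have ye: "y \<in> even_part UNIV x" using mult_eq_0_imp_zero_part[OF x xy] zero_part_even by blast
  obtain e t where c_eq: "c = e + t" and e: "e \<in> even_part UNIV x" and t: "t \<in> odd_part UNIV l l x"
    using axis_even_odd[OF x] .
  have "y \<star> c = \<phi> *s c + m *s w" by (rule axis_mult_decomp(2)[OF c dy(2,3,1)])
  hence eq: "y \<star> e + y \<star> t = (\<phi> *s e + m *s w) + \<phi> *s t"
    by (simp add: c_eq mult_add_right scale_right_distrib add_ac)
  have "y \<star> t = \<phi> *s t"
    using even_odd_unique[OF x axis_fusion(1)[OF x ye e] axis_fusion(2)[OF x ye t]
      subspace_add[OF subspace_even_part subspace_scale[OF subspace_even_part e] subspace_scale[OF subspace_even_part w]]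
      subspace_scale[OF subspace_odd_part t] eq] by simp
  hence "t \<in> span {y}" using axis_left_eigenvector[OF y _ \<phi>0 \<phi>m] by blast
  hence "t \<in> even_part UNIV x" using subspace_scale[OF subspace_even_part ye] by (auto simp: span_singleton)
  hence "t = 0" using even_odd_eq_0[OF x _ t] by blast
  with c_eq e obtain k z' where "c = k *s x + z'" "z' \<in> zero_part UNIV x" by (auto elim: even_partE)
  thus False using axis_even_neighbour[OF x c] xc by blast
qed


subsection \<open>Components of the axial graph\<close>

lemma sym_axial_graph: "sym axial_graph"
proof (rule symI)
  fix x y assume "(x, y) \<in> axial_graph"
  hence xy: "primitive_axis UNIV x" "primitive_axis UNIV y" "x \<noteq> y" "x \<star> y \<noteq> 0"
    by (auto simp: axial_graph_def)
  then obtain l d where "axis_of_type UNIV l d y" by (auto simp: primitive_axis_def)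
  hence "y \<star> x \<noteq> 0" using mult_eq_0_imp_zero_part xy(4) zero_partD by blast
  with xy show "(y, x) \<in> axial_graph" by (auto simp: axial_graph_def)
qed

lemma automorphism_primitive_axis:
  assumes "algebra_automorphism \<phi>" "primitive_axis UNIV x"
  shows "primitive_axis UNIV (\<phi> x)"
proof -
  obtain l d where "axis_of_type UNIV l d x" using assms(2) by (auto simp: primitive_axis_def)
  from automorphism_axis[OF assms(1) this] show ?thesis unfolding primitive_axis_def by (intro exI)
qed

lemma automorphism_axial_graph:
  assumes "algebra_automorphism \<phi>" "(x, y) \<in> axial_graph"
  shows "(\<phi> x, \<phi> y) \<in> axial_graph"
proof -
  have xy: "primitive_axis UNIV x" "primitive_axis UNIV y" "x \<noteq> y" "x \<star> y \<noteq> 0"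
    using assms(2) by (auto simp: axial_graph_def)
  have "primitive_axis UNIV (\<phi> x)" "primitive_axis UNIV (\<phi> y)"
    by (intro automorphism_primitive_axis[OF assms(1)] xy)+
  moreover have "\<phi> x \<star> \<phi> y \<noteq> 0"
    using xy(4) automorphismD(4)[OF assms(1), of "x \<star> y" 0]
    by (simp add: automorphismD(3)[OF assms(1)] automorphismD(5)[OF assms(1)])
  ultimately show ?thesis
    using xy(3) by (simp add: axial_graph_def automorphismD(4)[OF assms(1)])
qed

lemma neighbour_types:
  assumes "(x, y) \<in> axial_graph"
    and x: "axis_of_type UNIV l d x" and y: "axis_of_type UNIV l' d' y"
  shows "l \<noteq> d \<Longrightarrow> (l', d') = (l, d) \<or> (l', d') = (d, l)"
    and "l = d \<Longrightarrow> l' = d' \<and> (l' = l \<or> l' = 1 - l)"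
proof -
  have xy: "x \<star> y \<noteq> 0" "x \<noteq> y" and yx: "y \<star> x \<noteq> 0" "y \<noteq> x"
    using assms(1) symD[OF sym_axial_graph assms(1)] by (auto simp: axial_graph_def)
  show "(l', d') = (l, d) \<or> (l', d') = (d, l)" if "l \<noteq> d"
    by (rule noncommutative_neighbour[OF x y xy that])
  assume ld: "l = d"
  have ld': "l' = d'" using noncommutative_neighbour[OF y x yx] ld by blast
  obtain \<alpha> z w where dy: "y = \<alpha> *s x + z + w" "z \<in> zero_part UNIV x" "w \<in> odd_part UNIV l l x"
    using axis_decomp[OF x[folded ld] UNIV_I] .
  obtain \<beta> u v where dx: "x = \<beta> *s y + u + v" "u \<in> zero_part UNIV y" "v \<in> odd_part UNIV l' l' y"
    using axis_decomp[OF y[folded ld'] UNIV_I] .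
  have "l \<noteq> l' \<Longrightarrow> l + l' = 1"
    using commutative_neighbour(1)[OF x[folded ld] y[folded ld'] xy dy dx] by simp
  thus "l' = d' \<and> (l' = l \<or> l' = 1 - l)" using ld' by (auto simp: algebra_simps)
qed

section \<open>Uniform generation of each component\<close>

lemma component_uniformly_generated:
  assumes two: "(2::'f) \<noteq> 0" and ty: "type_choice ty"
    and good: "\<And>a. a \<in> S \<Longrightarrow> good_axis S a" and C: "C \<in> axial_components S"
  shows "uniformly_generated ty (gen_subalgebra C)"
proof -
  define E where "E = axial_graph \<inter> S \<times> S"
  define B where "B = gen_subalgebra C"
  obtain c0 where c0: "c0 \<in> S" "C = E\<^sup>* `` {c0}"
    using C unfolding axial_components_def E_def by (auto elim: quotientE)
  have symE: "sym E" using sym_axial_graph unfolding E_def sym_def by blast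
  have c0C: "c0 \<in> C" using c0 by simp
  have stepC: "y \<in> C" if "x \<in> C" "(x, y) \<in> E" for x y
    using that c0(2) by (auto intro: rtrancl_into_rtrancl)
  have CS: "C \<subseteq> S"
  proof
    fix x assume "x \<in> C"
    hence "(c0, x) \<in> E\<^sup>*" using c0(2) by simp
    thus "x \<in> S" by (induction rule: rtrancl_induct) (auto simp: c0(1) E_def)
  qed
  have conn: "(x, y) \<in> E\<^sup>*" if "x \<in> C" "y \<in> C" for x y
    using that c0(2) sym_rtrancl[OF symE] by (auto dest: symD intro: rtrancl_trans)
  have C_induct: "P y" if "x \<in> C" "P x" "\<And>u v. u \<in> C \<Longrightarrow> v \<in> C \<Longrightarrow> (u, v) \<in> E \<Longrightarrow> P u \<Longrightarrow> P v" "y \<in> C"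
    for P x y
  proof -
    have "y \<in> C \<and> P y" using conn[OF that(1,4)]
    proof (induction rule: rtrancl_induct)
      case base
      show ?case using that by simp
    next
      case (step u v)
      thus ?case using that(3) stepC by blast
    qed
    thus ?thesis ..
  qed
  have B: "subalgebra B" "C \<subseteq> B"
    unfolding B_def by (rule gen_subalgebra_subalgebra, rule gen_subalgebra_superset)
  have type_ex: "\<exists>l d. axis_of_type UNIV l d x" if "x \<in> C" for x
    using good CS that unfolding good_axis_def by blast
  have axB: "axis_of_type B l d x" if "x \<in> C" "axis_of_type UNIV l d x" for x l d
    using axis_restrict[OF that(2) B(1)] that(1) B(2) by blast
  have primB: "primitive_axis B x" if "x \<in> C" for x
    using type_ex[OF that] axB[OF that] unfolding primitive_axis_def by blast
  have result: ?thesis if "Y \<subseteq> C" "uniform (ty B) Y" "C \<subseteq> gen_subalgebra Y" for Y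
  proof -
    have "gen_subalgebra Y \<subseteq> B"
      by (rule gen_subalgebra_minimal) (use that B in auto)
    moreover have "B \<subseteq> gen_subalgebra Y"
      unfolding B_def by (rule gen_subalgebra_minimal[OF that(3) gen_subalgebra_subalgebra])
    ultimately have "gen_subalgebra Y = B" by blast
    thus ?thesis unfolding uniformly_generated_def B_def[symmetric] using that primB by blast
  qed
  note result_C = result[OF subset_refl _ gen_subalgebra_superset]
  show ?thesis
  proof (cases "C = {c0}")
    case True
    \<comment> \<open>A single axis is uniform whatever type was chosen for it.\<close>
    obtain l d where "ty B c0 = (l, d)" by (cases "ty B c0")
    hence "uniform (ty B) C" unfolding uniform_def True by (cases "l = d") auto
    thus ?thesis by (rule result_C)
  next
    case False
    have nbr: "\<exists>y\<in>C. (x, y) \<in> E" if "x \<in> C" for x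
    proof -
      obtain y where "y \<in> C" "y \<noteq> x" using False c0C by auto
      with conn[OF that this(1)] obtain v where "(x, v) \<in> E" by (auto elim: converse_rtranclE)
      thus ?thesis using stepC[OF that] by blast
    qed
    \<comment> \<open>The odd component of a neighbour of \<open>x\<close> is nonzero and lies in
      \<open>B\<close>, so the chosen type in \<open>B\<close> is forced to be the type in the whole
      algebra.\<close>
    have tyC: "ty B x = (l, d)" if x: "x \<in> C" "axis_of_type UNIV l d x" for x l d
    proof -
      obtain y where y: "y \<in> C" "(x, y) \<in> E" using nbr[OF x(1)] by blast
      obtain m n where m: "axis_of_type UNIV m n y" using type_ex[OF y(1)] by blast
      have "y \<in> B" using y(1) B(2) by blast
      then obtain k z w where d: "y = k *s x + z + w" "z \<in> zero_part B x" "w \<in> odd_part B l d x"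
        using axis_decomp[OF axB[OF x]] by metis
      have z: "z \<in> zero_part UNIV x" using d(2) by (simp add: zero_part_def)
      have "w \<noteq> 0" using axis_even_neighbour[OF x(2) m _ z, of k] d(1) y(2) by (auto simp: E_def axial_graph_def)
      moreover obtain l' d' where "ty B x = (l', d')" "axis_of_type B l' d' x"
        using ty B(1) primB[OF x(1)] unfolding type_choice_def by blast
      ultimately show ?thesis using axis_type_unique[OF axB[OF x] _ d(3)] by blast
    qed
    have axC: "axis_of_type UNIV l d x" if "x \<in> C" "ty B x = (l, d)" for x l d
      using type_ex[OF that(1)] tyC[OF that(1)] that(2) by auto
    obtain l0 d0 where l0: "ty B c0 = (l0, d0)" by (cases "ty B c0")
    show ?thesis
    proof (cases "l0 = d0")
      case ne: False
      have "ty B y = (l0, d0) \<or> ty B y = (d0, l0)" if "y \<in> C" for y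
        using c0C _ _ that
      proof (rule C_induct)
        show "ty B c0 = (l0, d0) \<or> ty B c0 = (d0, l0)" using l0 by simp
      next
        fix u v assume uv: "u \<in> C" "v \<in> C" "(u, v) \<in> E" "ty B u = (l0, d0) \<or> ty B u = (d0, l0)"
        obtain m n where v: "axis_of_type UNIV m n v" using type_ex[OF uv(2)] by blast
        have "(u, v) \<in> axial_graph" using uv(3) by (simp add: E_def)
        from neighbour_types(1)[OF this _ v] have "(m, n) = (l0, d0) \<or> (m, n) = (d0, l0)"
          using uv(4) axC[OF uv(1)] ne by metis
        thus "ty B v = (l0, d0) \<or> ty B v = (d0, l0)" using tyC[OF uv(2) v] by simp
      qed
      hence "uniform (ty B) C" using ne unfolding uniform_def by blast
      thus ?thesis by (rule result_C)
    next
      case eq: True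
      have two_types: "ty B y = (l0, l0) \<or> ty B y = (1 - l0, 1 - l0)" if "y \<in> C" for y
        using c0C _ _ that
      proof (rule C_induct)
        show "ty B c0 = (l0, l0) \<or> ty B c0 = (1 - l0, 1 - l0)" using l0 eq by simp
      next
        fix u v assume uv: "u \<in> C" "v \<in> C" "(u, v) \<in> E" "ty B u = (l0, l0) \<or> ty B u = (1 - l0, 1 - l0)"
        obtain m n where v: "axis_of_type UNIV m n v" using type_ex[OF uv(2)] by blast
        have e: "(u, v) \<in> axial_graph" using uv(3) by (simp add: E_def)
        have "m = n \<and> (m = l0 \<or> m = 1 - l0)"
          using uv(4) neighbour_types(2)[OF e axC[OF uv(1)] v, of l0 l0]
            neighbour_types(2)[OF e axC[OF uv(1)] v, of "1 - l0" "1 - l0"] by auto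
        thus "ty B v = (l0, l0) \<or> ty B v = (1 - l0, 1 - l0)" using tyC[OF uv(2) v] by auto
      qed
      show ?thesis
      proof (cases "\<forall>y\<in>C. ty B y = (l0, l0)")
        case True
        hence "uniform (ty B) C" unfolding uniform_def by blast
        thus ?thesis by (rule result_C)
      next
        case False
        then obtain y1 where y1: "y1 \<in> C" "ty B y1 = (1 - l0, 1 - l0)" "1 - l0 \<noteq> l0"
          using two_types by force
        have half: "2 * l0 \<noteq> 1"
        proof
          assume "2 * l0 = 1"
          hence "1 - l0 = l0" by algebra
          thus False using y1(3) by simp
        qed
        obtain l where l: "l \<noteq> - 1" "2 * l \<noteq> 1" "\<And>y. y \<in> C \<Longrightarrow> ty B y = (l, l) \<or> ty B y = (1 - l, 1 - l)"
          and l_ex: "\<exists>y\<in>C. ty B y = (l, l)"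
        proof (cases "l0 = - 1")
          case False
          thus ?thesis using that[of l0] half two_types c0C l0 eq by blast
        next
          case True
          \<comment> \<open>Both types equal to -1 would mean 2 = -1, and then
            \<open>2 * l0 = 1\<close>, which \<open>half\<close> excludes.\<close>
          have "1 - l0 \<noteq> - 1"
          proof
            assume "1 - l0 = - 1"
            hence "(2::'f) = - 1" using True by simp
            hence "2 * l0 = (- 1) * (- 1)" using True by metis
            thus False using half by simp
          qed
          moreover have "2 * (1 - l0) \<noteq> 1"
          proof
            assume "2 * (1 - l0) = 1"
            hence "2 * l0 = 1" by algebra
            thus False using half by simp
          qed
          ultimately show ?thesis using that[of "1 - l0"] two_types y1 by auto
        qed
        define m where "m = 1 - l"
        have m: "2 * m \<noteq> 1" "l \<noteq> m"
        proof -
          show "2 * m \<noteq> 1"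
          proof
            assume "2 * m = 1"
            hence "2 * l = 1" unfolding m_def by algebra
            thus False using l by simp
          qed
          show "l \<noteq> m"
          proof
            assume "l = m"
            hence "2 * l = 1" unfolding m_def by algebra
            thus False using l by simp
          qed
        qed
        define Y where "Y = {y \<in> C. ty B y = (l, l)}"
        have Y_ax: "axis_of_type UNIV l l y" if "y \<in> Y" for y
          using axC that by (simp add: Y_def)
        \<comment> \<open>The involution of \<open>c\<close> is a graph automorphism fixing
          \<open>c\<close>, so it preserves the component, and automorphisms preserve types.\<close>
        have refl_m: "\<exists>\<tau>. is_miyamoto m m c \<tau> \<and> (\<forall>b\<in>Y. \<tau> b \<in> Y)" if c: "c \<in> C" "ty B c = (m, m)" for c
        proof -
          obtain l' d' \<tau> where \<tau>: "axis_of_type UNIV l' d' c" "is_miyamoto l' d' c \<tau>" "\<tau> ` S \<subseteq> S"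
            using good CS c(1) unfolding good_axis_def by blast
          have mm: "l' = m" "d' = m" using tyC[OF c(1) \<tau>(1)] c(2) by auto
          note aut = is_miyamoto_automorphism[OF \<tau>(2)]
          have "\<tau> b \<in> Y" if b: "b \<in> Y" for b
          proof -
            have "b \<in> C" using b by (simp add: Y_def)
            from conn[OF c(1) this] have "(c, \<tau> b) \<in> E\<^sup>*"
            proof (induction rule: rtrancl_induct)
              case base
              show ?case by (simp add: is_miyamoto_self[OF \<tau>(2)])
            next
              case (step u v)
              have "(\<tau> u, \<tau> v) \<in> E"
                using step(2) \<tau>(3) automorphism_axial_graph[OF aut] unfolding E_def by blast
              with step(3) show ?case by (rule rtrancl_into_rtrancl)
            qed
            hence "\<tau> b \<in> C" using c(1) c0(2) by (auto intro: rtrancl_trans)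
            thus ?thesis
              using tyC automorphism_axis[OF aut Y_ax[OF b]] by (simp add: Y_def)
          qed
          thus ?thesis using \<tau>(2) mm by blast
        qed
        \<comment> \<open>Induction along paths from an axis of type \<open>l\<close>: if neither
          end of an edge has that type, a neighbour \<open>x\<close> of the first end or its
          reflection \<open>\<tau> x\<close> is adjacent to the second.\<close>
        have near: "ty B y = (l, l) \<or> (\<exists>x\<in>Y. (x, y) \<in> E)" if y: "y \<in> C" for y
        proof -
          obtain x0 where x0: "x0 \<in> C" "ty B x0 = (l, l)" using l_ex by blast
          show ?thesis using x0(1) _ _ y
          proof (rule C_induct)
            show "ty B x0 = (l, l) \<or> (\<exists>x\<in>Y. (x, x0) \<in> E)" using x0 by simp
          next
            fix c y assume cy: "c \<in> C" "y \<in> C" "(c, y) \<in> E" "ty B c = (l, l) \<or> (\<exists>x\<in>Y. (x, c) \<in> E)"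
            show "ty B y = (l, l) \<or> (\<exists>x\<in>Y. (x, y) \<in> E)"
            proof (cases "ty B y = (l, l) \<or> ty B c = (l, l)")
              case True
              thus ?thesis using cy(1,3) by (auto simp: Y_def)
            next
              case False
              then obtain x where x: "x \<in> Y" "(x, c) \<in> E" using cy(4) by blast
              have ty_m: "ty B y = (m, m)" "ty B c = (m, m)"
                using l(3)[OF cy(2)] l(3)[OF cy(1)] False by (auto simp: m_def)
              obtain \<tau> where \<tau>: "is_miyamoto m m c \<tau>" "\<forall>b\<in>Y. \<tau> b \<in> Y" using refl_m[OF cy(1) ty_m(2)] by blast
              note c_ax = axC[OF cy(1) ty_m(2)] and y_ax = axC[OF cy(2) ty_m(1)]
              note aut = is_miyamoto_automorphism[OF \<tau>(1)]
              have edge: "(x', y) \<in> E" if "x' \<in> Y" "x' \<star> y \<noteq> 0" for x'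
              proof -
                have "x' \<noteq> y" using that(1) False by (auto simp: Y_def)
                moreover have "primitive_axis UNIV x'" "primitive_axis UNIV y"
                  using Y_ax[OF that(1)] y_ax unfolding primitive_axis_def by blast+
                moreover have "x' \<in> S" "y \<in> S" using that(1) cy(2) CS by (auto simp: Y_def)
                ultimately show ?thesis using that(2) by (simp add: E_def axial_graph_def)
              qed
              have "x \<star> y \<noteq> 0 \<or> x \<star> \<tau> y \<noteq> 0"
                using not_orthogonal_to_both[OF two Y_ax[OF x(1)] c_ax y_ax m(1) \<tau>(1)] x(2) cy(3)
                by (auto simp: E_def axial_graph_def)
              moreover have "\<tau> x \<star> y = \<tau> (x \<star> \<tau> y)"
                by (simp add: automorphismD(3)[OF aut] is_miyamoto_involution[OF c_ax \<tau>(1)])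
              ultimately have "x \<star> y \<noteq> 0 \<or> \<tau> x \<star> y \<noteq> 0"
                using automorphismD(4)[OF aut, of "x \<star> \<tau> y" 0] by (simp add: automorphismD(5)[OF aut])
              thus ?thesis using edge x(1) \<tau>(2) by blast
            qed
          qed
        qed
        have "C \<subseteq> gen_subalgebra Y"
        proof
          fix y assume y: "y \<in> C"
          have YG: "Y \<subseteq> gen_subalgebra Y" by (rule gen_subalgebra_superset)
          show "y \<in> gen_subalgebra Y"
          proof (cases "ty B y = (l, l)")
            case True
            thus ?thesis using y YG by (auto simp: Y_def)
          next
            case False
            hence ty_m: "ty B y = (m, m)" using l(3)[OF y] by (simp add: m_def)
            obtain x where x: "x \<in> Y" "(x, y) \<in> E" using near[OF y] False by blast
            obtain \<tau> where \<tau>: "is_miyamoto m m y \<tau>" "\<forall>b\<in>Y. \<tau> b \<in> Y" using refl_m[OF y ty_m] by blast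
            show ?thesis
            proof (rule mixed_pair_generates[OF two Y_ax[OF x(1)] axC[OF y ty_m] _ m(2) l(1) \<tau>(1)])
              show "x \<star> y \<noteq> 0" using x(2) by (simp add: E_def axial_graph_def)
              show "subalgebra (gen_subalgebra Y)" by (rule gen_subalgebra_subalgebra)
              show "x \<in> gen_subalgebra Y" "\<tau> x \<in> gen_subalgebra Y" using x(1) \<tau>(2) YG by auto
            qed
          qed
        qed
        moreover have "uniform (ty B) Y" unfolding uniform_def Y_def by blast
        moreover have "Y \<subseteq> C" by (auto simp: Y_def)
        ultimately show ?thesis by (intro result)
      qed
    qed
  qed
qed

section \<open>Sum over the components and conclusion\<close>

lemma span_subset_family_sum:
  assumes "S \<subseteq> \<Union>I" "\<And>C. C \<in> I \<Longrightarrow> subspace (V C) \<and> C \<subseteq> V C"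
  shows "span S \<subseteq> family_sum V I"
proof
  fix v assume "v \<in> span S"
  thus "v \<in> family_sum V I"
  proof (induction rule: span_induct_alt)
    case base
    show ?case unfolding family_sum_def by (auto intro: exI[of _ "{}"])
  next
    case (step c x y)
    then obtain J f where J: "y = sum f J" "finite J" "J \<subseteq> I" "\<forall>C\<in>J. f C \<in> V C"
      unfolding family_sum_def by blast
    obtain D where D: "x \<in> D" "D \<in> I" using step(1) assms(1) by blast
    have cx: "c *s x \<in> V D" using D assms(2) subspace_scale by blast
    \<comment> \<open>A sum has one term per index, so the new vector is merged with the term at
      \<open>D\<close> when \<open>D\<close> already lies in \<open>J\<close>.\<close>
    define g where "g C = (if C = D then c *s x else 0) + (if C \<in> J then f C else 0)" for C
    have "sum g (insert D J) = c *s x + y"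
    proof -
      have "(\<Sum>C\<in>insert D J. if C \<in> J then f C else 0) = y"
        unfolding J(1) by (rule sum.mono_neutral_cong_right) (use J(2) in auto)
      thus ?thesis unfolding g_def using J(2) by (simp add: sum.distrib)
    qed
    moreover have "g C \<in> V C" if "C \<in> insert D J" for C
    proof -
      have sub: "subspace (V C)" using that D(2) J(3) assms(2) by blast
      show ?thesis unfolding g_def
        by (rule subspace_add[OF sub]) (use cx J(4) subspace_0[OF sub] in auto)
    qed
    ultimately show ?case
      unfolding family_sum_def using J(2,3) D(2)
      by (intro CollectI exI[of _ "insert D J"] exI[of _ g]) auto
  qed
qed

end

theorem theoremB:
  fixes scale :: "'f::field \<Rightarrow> 'a::ab_group_add \<Rightarrow> 'a"
    and mult :: "'a \<Rightarrow> 'a \<Rightarrow> 'a"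
    and ty :: "'a set \<Rightarrow> 'a \<Rightarrow> 'f \<times> 'f"
    and X :: "'a set"
  assumes "nonassoc_algebra scale mult"
    and "CHAR('f) \<noteq> 2"
    and "nonassoc_algebra.type_choice scale mult ty"
    and "\<forall>x\<in>X. nonassoc_algebra.primitive_axis scale mult UNIV x"
    and "nonassoc_algebra.gen_subalgebra scale mult X = UNIV"
  shows "nonassoc_algebra.family_sum (nonassoc_algebra.gen_subalgebra scale mult)
           (nonassoc_algebra.axial_components scale mult
             (nonassoc_algebra.axis_closure scale mult ty X)) = UNIV \<and>
         (\<forall>C \<in> nonassoc_algebra.axial_components scale mult
                 (nonassoc_algebra.axis_closure scale mult ty X).
            nonassoc_algebra.uniformly_generated scale mult ty
              (nonassoc_algebra.gen_subalgebra scale mult C))"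
proof -
  interpret nonassoc_algebra scale mult by (rule assms(1))
  let ?S = "axis_closure ty X"
  have two: "(2::'f) \<noteq> 0"
  proof
    assume "(2::'f) = 0"
    hence "of_nat 2 = (0::'f)" by simp
    \<comment> \<open>The characteristic would divide 2, and it is neither 1 nor 2.\<close>
    hence "CHAR('f) dvd 2" by (simp only: of_nat_eq_0_iff_char_dvd)
    moreover from this have "CHAR('f) \<noteq> 0" by (metis dvd_0_left_iff zero_neq_numeral)
    ultimately have "CHAR('f) \<noteq> 0" "CHAR('f) \<le> 2" by (auto dest: dvd_imp_le)
    thus False using assms(2) CHAR_not_1'[where ?'a = 'f] by linarith
  qed
  note good = axis_closure_good[OF assms(3,4)]
  have "gen_subalgebra X \<subseteq> span ?S"
    using good(1) span_superset by (intro gen_subalgebra_minimal span_good_axes_subalgebra two good(2)) auto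
  hence "span ?S = UNIV" using assms(5) by blast
  moreover have "span ?S \<subseteq> family_sum gen_subalgebra (axial_components ?S)"
  proof (rule span_subset_family_sum)
    show "?S \<subseteq> \<Union>(axial_components ?S)"
      unfolding axial_components_def by (auto simp: quotient_def)
    show "subspace (gen_subalgebra C) \<and> C \<subseteq> gen_subalgebra C" for C
      using gen_subalgebra_subalgebra gen_subalgebra_superset by (auto simp: subalgebra_def)
  qed
  ultimately show ?thesis
    using component_uniformly_generated[OF two assms(3) good(2)] by blast
qed

end
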